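(* Let $R$ be a ring ($K$-algebra) with identity, let $t\geq 1$ be an integer, and let $\sigma:R\longrightarrow R$ be a ring ($K$-algebra) endomorphism with $\sigma^{t}=1$ (the identity map). For $r_0,r_1,\ldots,r_{t-1}\in R$ put $$\mu(r_{0}+r_{1}w+\cdots+r_{t-1}w^{t-1}+(w^{t}))=\left[\sigma^{i-1}(r_{j-i})z^{j-i}+(z^{t})\right]_{t\times t},$$ the $t\times t$ matrix whose $(i,j)$ entry ($1\leq i,j\leq t$) is the element $\sigma^{i-1}(r_{j-i})z^{j-i}+(z^{t})$ of $R[z]/(z^{t})$, where the difference $j-i\in\{0,1,\ldots,t-1\}$ is taken modulo $t$ (both in the index of $r_{j-i}$ and in the exponent of $z$). Then $\mu$ is an embedding $$\mu:R[w,\sigma]/(w^{t})\longrightarrow \mathrm{M}_{t}(R[z]/(z^{t}))$$ of rings ($K$-algebras). Moreover, the trace of this matrix is in the fixed ring $R^{\sigma}=\{r\in R\mid\sigma(r)=r\}$, in the sense that $$\mathrm{tr}(\mu(r_{0}+r_{1}w+\cdots+r_{t-1}w^{t-1}+(w^{t})))=r_{0}+\sigma(r_{0})+\cdots+\sigma^{t-1}(r_{0})+(z^{t})\in R^{\sigma}+(z^{t}).$$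
   Context: $K$ is a field of characteristic zero; the statement is made both for rings and for $K$-algebras. $R[w,\sigma]$ is the skew polynomial ring: its elements are left polynomials $r_0+r_1w+\cdots+r_kw^k$ with $r_i\in R$, with the obvious addition and with multiplication determined by $wr=\sigma(r)w$ for all $r\in R$. $(w^t)$ is the two-sided ideal of $R[w,\sigma]$ generated by $w^t$. Since $\sigma^t=1$, $w^t$ is central, and each element of $R[w,\sigma]/(w^t)$ is $r_0+r_1w+\cdots+r_{t-1}w^{t-1}+(w^t)$ for a unique sequence $r_0,\ldots,r_{t-1}\in R$. $R[z]$ is the ordinary polynomial ring over the (not necessarily commutative) ring $R$ in an indeterminate $z$ commuting with the elements of $R$, and $(z^t)$ is the ideal generated by $z^t$. $\mathrm{M}_t(S)$ is the ring of $t\times t$ matrices over $S$. $R^{\sigma}+(z^t)$ denotes the set of cosets $r+(z^t)$ in $R[z]/(z^t)$ with $r\in R^\sigma$. An embedding is an injective ring ($K$-algebra) homomorphism. *)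

theory Defs
  imports "Jordan_Normal_Form.Matrix" "HOL-Algebra.UnivPoly" "HOL-Algebra.QuotRing"
begin

section \<open>Not necessarily commutative algebras over a field\<close>

text \<open>The library locale \<open>algebra\<close> requires the algebra to be a commutative ring.\<close>

locale nc_algebra = Module.module K A + A?: ring A for K (structure) and A (structure) +
  assumes smult_mult_left:
      "\<lbrakk>k \<in> carrier K; a \<in> carrier A; b \<in> carrier A\<rbrakk> \<Longrightarrow>
        k \<odot>\<^bsub>A\<^esub> (a \<otimes>\<^bsub>A\<^esub> b) = (k \<odot>\<^bsub>A\<^esub> a) \<otimes>\<^bsub>A\<^esub> b"
    and smult_mult_right:
      "\<lbrakk>k \<in> carrier K; a \<in> carrier A; b \<in> carrier A\<rbrakk> \<Longrightarrow>
        k \<odot>\<^bsub>A\<^esub> (a \<otimes>\<^bsub>A\<^esub> b) = a \<otimes>\<^bsub>A\<^esub> (k \<odot>\<^bsub>A\<^esub> b)"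

locale char_zero_field = Ring.field K for K (structure) +
  assumes char_zero: "n > 0 \<Longrightarrow> add_pow K (n::nat) \<one>\<^bsub>K\<^esub> \<noteq> \<zero>\<^bsub>K\<^esub>"

definition alg_hom ::
  "('k, 'n) ring_scheme \<Rightarrow> ('k, 'a, 'p) module_scheme \<Rightarrow> ('k, 'b, 'q) module_scheme \<Rightarrow> ('a \<Rightarrow> 'b) set"
  where "alg_hom K A B =
    {f \<in> Ring.ring_hom A B. \<forall>k\<in>carrier K. \<forall>a\<in>carrier A. f (k \<odot>\<^bsub>A\<^esub> a) = k \<odot>\<^bsub>B\<^esub> f a}"

definition ring_embedding ::
  "('a, 'm) ring_scheme \<Rightarrow> ('b, 'n) ring_scheme \<Rightarrow> ('a \<Rightarrow> 'b) \<Rightarrow> bool"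
  where "ring_embedding R S f \<longleftrightarrow> ring_hom_ring R S f \<and> inj_on f (carrier R)"

definition alg_embedding ::
  "('k, 'n) ring_scheme \<Rightarrow> ('k, 'a, 'p) module_scheme \<Rightarrow> ('k, 'b, 'q) module_scheme \<Rightarrow> ('a \<Rightarrow> 'b) \<Rightarrow> bool"
  where "alg_embedding K A B f \<longleftrightarrow>
    nc_algebra K A \<and> nc_algebra K B \<and> f \<in> alg_hom K A B \<and> inj_on f (carrier A)"

definition with_smult :: "('a, 'm) ring_scheme \<Rightarrow> ('k \<Rightarrow> 'a \<Rightarrow> 'a) \<Rightarrow> ('k, 'a) module"
  where "with_smult R s = \<lparr>carrier = carrier R, mult = mult R, one = one R,
    zero = zero R, add = add R, smult = s\<rparr>"

text \<open>The scalar action \<open>k (a + I) = k a + I\<close> induced on the cosets of an ideal.\<close>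

definition quot_smult :: "('a, 'm) ring_scheme \<Rightarrow> 'a set \<Rightarrow> ('k \<Rightarrow> 'a \<Rightarrow> 'a) \<Rightarrow> 'k \<Rightarrow> 'a set \<Rightarrow> 'a set"
  where "quot_smult R I s k X = (\<Union>a\<in>X. I +>\<^bsub>R\<^esub> s k a)"

text \<open>Scalar action on coefficient sequences. The field \<open>smult\<close> of \<open>UP A\<close> is multiplication by
  elements of \<open>A\<close>, so it cannot be used for the \<open>K\<close>-algebra structure of the polynomial ring.\<close>

definition coeff_smult :: "('k, 'a, 'p) module_scheme \<Rightarrow> 'k \<Rightarrow> (nat \<Rightarrow> 'a) \<Rightarrow> nat \<Rightarrow> 'a"
  where "coeff_smult A k p = (\<lambda>i. k \<odot>\<^bsub>A\<^esub> p i)"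


section \<open>Skew polynomials\<close>

text \<open>As for \<open>UP\<close>, the left polynomial \<open>r\<^sub>0 + r\<^sub>1 w + \<dots> + r\<^sub>k w\<^sup>k\<close> is its coefficient
  sequence. The rule \<open>w r = \<sigma>(r) w\<close> gives \<open>(a w\<^sup>m) (b w\<^sup>n) = a \<sigma>\<^sup>m(b) w\<^sup>m\<^sup>+\<^sup>n\<close> (see
  \<open>skew_monom_mult\<close>), whence the product formula.\<close>

definition skew_poly :: "('a, 'm) ring_scheme \<Rightarrow> ('a \<Rightarrow> 'a) \<Rightarrow> (nat \<Rightarrow> 'a) ring"
  where "skew_poly R \<sigma> = \<lparr>
    carrier = up R,
    mult = (\<lambda>p q n. \<Oplus>\<^bsub>R\<^esub>i\<in>{..n}. p i \<otimes>\<^bsub>R\<^esub> (\<sigma> ^^ i) (q (n - i))),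
    one = (\<lambda>i. if i = 0 then \<one>\<^bsub>R\<^esub> else \<zero>\<^bsub>R\<^esub>),
    zero = (\<lambda>i. \<zero>\<^bsub>R\<^esub>),
    add = (\<lambda>p q i. p i \<oplus>\<^bsub>R\<^esub> q i)\<rparr>"

definition skew_monom :: "('a, 'm) ring_scheme \<Rightarrow> 'a \<Rightarrow> nat \<Rightarrow> nat \<Rightarrow> 'a"
  where "skew_monom R a n = (\<lambda>i. if i = n then a else \<zero>\<^bsub>R\<^esub>)"

definition skew_var :: "('a, 'm) ring_scheme \<Rightarrow> nat \<Rightarrow> 'a"
  where "skew_var R = skew_monom R \<one>\<^bsub>R\<^esub> 1"

definition skew_ideal :: "('a, 'm) ring_scheme \<Rightarrow> ('a \<Rightarrow> 'a) \<Rightarrow> nat \<Rightarrow> (nat \<Rightarrow> 'a) set"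
  where "skew_ideal R \<sigma> t = Idl\<^bsub>skew_poly R \<sigma>\<^esub> {skew_var R [^]\<^bsub>skew_poly R \<sigma>\<^esub> t}"

definition skew_quot :: "('a, 'm) ring_scheme \<Rightarrow> ('a \<Rightarrow> 'a) \<Rightarrow> nat \<Rightarrow> (nat \<Rightarrow> 'a) set ring"
  where "skew_quot R \<sigma> t = skew_poly R \<sigma> Quot skew_ideal R \<sigma> t"

definition skew_quot_alg ::
  "('k, 'a, 'p) module_scheme \<Rightarrow> ('a \<Rightarrow> 'a) \<Rightarrow> nat \<Rightarrow> ('k, (nat \<Rightarrow> 'a) set) module"
  where "skew_quot_alg A \<sigma> t = with_smult (skew_quot A \<sigma> t)
    (quot_smult (skew_poly A \<sigma>) (skew_ideal A \<sigma> t) (coeff_smult A))"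

text \<open>The coset \<open>r\<^sub>0 + r\<^sub>1 w + \<dots> + r\<^sub>t\<^sub>-\<^sub>1 w\<^sup>t\<^sup>-\<^sup>1 + (w\<^sup>t)\<close>; only \<open>r i\<close> with \<open>i < t\<close> matter.\<close>

definition skew_coset :: "('a, 'm) ring_scheme \<Rightarrow> ('a \<Rightarrow> 'a) \<Rightarrow> nat \<Rightarrow> (nat \<Rightarrow> 'a) \<Rightarrow> (nat \<Rightarrow> 'a) set"
  where "skew_coset R \<sigma> t r =
    skew_ideal R \<sigma> t +>\<^bsub>skew_poly R \<sigma>\<^esub> (\<lambda>i. if i < t then r i else \<zero>\<^bsub>R\<^esub>)"


section \<open>Truncated polynomials\<close>

text \<open>\<open>UP R\<close> is a ring for every ring \<open>R\<close>, commutative or not, with central indeterminate.\<close>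

definition poly_ideal :: "('a, 'm) ring_scheme \<Rightarrow> nat \<Rightarrow> (nat \<Rightarrow> 'a) set"
  where "poly_ideal R t = Idl\<^bsub>UP R\<^esub> {up_ring.monom (UP R) \<one>\<^bsub>R\<^esub> t}"

definition poly_quot :: "('a, 'm) ring_scheme \<Rightarrow> nat \<Rightarrow> (nat \<Rightarrow> 'a) set ring"
  where "poly_quot R t = UP R Quot poly_ideal R t"

definition poly_quot_alg :: "('k, 'a, 'p) module_scheme \<Rightarrow> nat \<Rightarrow> ('k, (nat \<Rightarrow> 'a) set) module"
  where "poly_quot_alg A t = with_smult (poly_quot A t)
    (quot_smult (UP A) (poly_ideal A t) (coeff_smult A))"

text \<open>The coset \<open>a z\<^sup>n + (z\<^sup>t)\<close>.\<close>

definition poly_coset :: "('a, 'm) ring_scheme \<Rightarrow> nat \<Rightarrow> 'a \<Rightarrow> nat \<Rightarrow> (nat \<Rightarrow> 'a) set"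
  where "poly_coset R t a n = poly_ideal R t +>\<^bsub>UP R\<^esub> up_ring.monom (UP R) a n"

definition fixed_ring :: "('a, 'm) ring_scheme \<Rightarrow> ('a \<Rightarrow> 'a) \<Rightarrow> 'a set"
  where "fixed_ring R \<sigma> = {r \<in> carrier R. \<sigma> r = r}"


section \<open>Matrices over a ring with carrier\<close>

text \<open>The library matrix operations use the type class operations on the entries, so
  they are restated here for the operations of a ring \<open>S\<close>; indices run from \<open>0\<close>.\<close>

definition matrix_ring :: "nat \<Rightarrow> ('a, 'm) ring_scheme \<Rightarrow> 'a mat ring"
  where "matrix_ring n S = \<lparr>
    carrier = {M \<in> carrier_mat n n. \<forall>i<n. \<forall>j<n. M $$ (i, j) \<in> carrier S},
    mult = (\<lambda>M N. mat n n (\<lambda>(i, j). \<Oplus>\<^bsub>S\<^esub>k\<in>{..<n}. M $$ (i, k) \<otimes>\<^bsub>S\<^esub> N $$ (k, j))),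
    one = mat n n (\<lambda>(i, j). if i = j then \<one>\<^bsub>S\<^esub> else \<zero>\<^bsub>S\<^esub>),
    zero = mat n n (\<lambda>(i, j). \<zero>\<^bsub>S\<^esub>),
    add = (\<lambda>M N. mat n n (\<lambda>(i, j). M $$ (i, j) \<oplus>\<^bsub>S\<^esub> N $$ (i, j)))\<rparr>"

definition matrix_alg :: "nat \<Rightarrow> ('k, 'a, 'p) module_scheme \<Rightarrow> ('k, 'a mat) module"
  where "matrix_alg n S = with_smult (matrix_ring n S)
    (\<lambda>k M. mat n n (\<lambda>(i, j). k \<odot>\<^bsub>S\<^esub> M $$ (i, j)))"

definition matrix_trace :: "('a, 'm) ring_scheme \<Rightarrow> 'a mat \<Rightarrow> 'a"
  where "matrix_trace S M = (\<Oplus>\<^bsub>S\<^esub>i\<in>{..<dim_row M}. M $$ (i, i))"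


section \<open>The map\<close>

text \<open>With indices from \<open>0\<close>, the exponent \<open>i - 1\<close> of \<open>\<sigma>\<close> becomes \<open>i\<close>, and \<open>j - i\<close> is unchanged.\<close>

definition mu_matrix :: "('a, 'm) ring_scheme \<Rightarrow> ('a \<Rightarrow> 'a) \<Rightarrow> nat \<Rightarrow> (nat \<Rightarrow> 'a) \<Rightarrow> (nat \<Rightarrow> 'a) set mat"
  where "mu_matrix R \<sigma> t r = mat t t (\<lambda>(i, j).
    let d = nat ((int j - int i) mod int t) in poly_coset R t ((\<sigma> ^^ i) (r d)) d)"

text \<open>\<open>\<mu>\<close> is defined on cosets through the unique representing sequence of coefficients.\<close>

definition mu :: "('a, 'm) ring_scheme \<Rightarrow> ('a \<Rightarrow> 'a) \<Rightarrow> nat \<Rightarrow> (nat \<Rightarrow> 'a) set \<Rightarrow> (nat \<Rightarrow> 'a) set mat"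
  where "mu R \<sigma> t X =
    mu_matrix R \<sigma> t (THE r. r \<in> {..<t} \<rightarrow>\<^sub>E carrier R \<and> skew_coset R \<sigma> t r = X)"


section \<open>Multiplication of skew monomials\<close>

lemma skew_monom_mult:
  assumes R: "ring R" and s: "\<sigma> \<in> Ring.ring_hom R R" and a: "a \<in> carrier R" and b: "b \<in> carrier R"
  shows "skew_monom R a m \<otimes>\<^bsub>skew_poly R \<sigma>\<^esub> skew_monom R b n
    = skew_monom R (a \<otimes>\<^bsub>R\<^esub> (\<sigma> ^^ m) b) (m + n)"
proof
  fix k
  interpret ring R by (rule R)
  have c: "(\<sigma> ^^ i) x \<in> carrier R" if "x \<in> carrier R" for i x
    using that by (induction i) (auto intro: ring_hom_closed[OF s])
  have z: "(\<sigma> ^^ i) \<zero>\<^bsub>R\<^esub> = \<zero>\<^bsub>R\<^esub>" for i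
    by (induction i) (auto simp: ring_hom_zero[OF s R R])
  let ?f = "\<lambda>i. skew_monom R a m i \<otimes>\<^bsub>R\<^esub> (\<sigma> ^^ i) (skew_monom R b n (k - i))"
  let ?g = "\<lambda>i. if m = i then (if k = m + n then a \<otimes>\<^bsub>R\<^esub> (\<sigma> ^^ m) b else \<zero>\<^bsub>R\<^esub>) else \<zero>\<^bsub>R\<^esub>"
  have "finsum R ?f {..k} = finsum R ?g {..k}"
    using a b by (intro finsum_cong') (auto simp: skew_monom_def z c)
  also have "\<dots> = skew_monom R (a \<otimes>\<^bsub>R\<^esub> (\<sigma> ^^ m) b) (m + n) k"
  proof (cases "m \<le> k")
    case True
    then show ?thesis
      using a b c
        finsum_singleton[of m "{..k}" "\<lambda>_. if k = m + n then a \<otimes>\<^bsub>R\<^esub> (\<sigma> ^^ m) b else \<zero>\<^bsub>R\<^esub>"]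
      by (auto simp: skew_monom_def)
  next
    case False
    then have "finsum R ?g {..k} = finsum R (\<lambda>_. \<zero>\<^bsub>R\<^esub>) {..k}"
      by (intro finsum_cong') auto
    with False show ?thesis by (auto simp: skew_monom_def)
  qed
  finally show "(skew_monom R a m \<otimes>\<^bsub>skew_poly R \<sigma>\<^esub> skew_monom R b n) k
    = skew_monom R (a \<otimes>\<^bsub>R\<^esub> (\<sigma> ^^ m) b) (m + n) k"
    by (simp add: skew_poly_def)
qed

end

theory Submission
  imports Defs
begin

text \<open>
  The ideals \<open>(w\<^sup>t)\<close> and \<open>(z\<^sup>t)\<close> consist of the polynomials whose coefficients below degree \<open>t\<close>
  vanish, so cosets are determined by these coefficients, and \<open>\<mu>\<close> is injective because the first row
  of the matrix displays them. For multiplicativity, entry \<open>(i, j)\<close> of a matrix product is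
  \<open>\<Sum>\<^sub>k \<sigma>\<^sup>i(p\<^sub>k\<^sub>-\<^sub>i) \<sigma>\<^sup>k(q\<^sub>j\<^sub>-\<^sub>k) z\<^bsup>(k - i) + (j - k)\<^esup>\<close>. With \<open>e = k - i\<close> and \<open>d = j - i\<close> modulo \<open>t\<close>, \<open>\<sigma>\<^sup>t = 1\<close> gives
  \<open>\<sigma>\<^sup>k = \<sigma>\<^sup>i \<sigma>\<^sup>e\<close>; the exponent is \<open>d\<close> if \<open>e \<le> d\<close> and \<open>d + t\<close> otherwise. What survives modulo \<open>z\<^sup>t\<close>
  is \<open>\<sigma>\<^sup>i(\<Sum>\<^sub>e\<^sub>\<le>\<^sub>d p\<^sub>e \<sigma>\<^sup>e(q\<^sub>d\<^sub>-\<^sub>e)) z\<^sup>d\<close>, the image of the skew product.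
\<close>

section \<open>Finite sums\<close>

lemma (in abelian_monoid) finsum_swap:
  assumes "finite I" "finite J" and "\<And>i j. i \<in> I \<Longrightarrow> j \<in> J \<Longrightarrow> f i j \<in> carrier G"
  shows "(\<Oplus>i\<in>I. \<Oplus>j\<in>J. f i j) = (\<Oplus>j\<in>J. \<Oplus>i\<in>I. f i j)"
  using assms(1,3)
proof (induction I rule: finite_induct)
  case empty
  then show ?case by (simp add: finsum_zero)
next
  case (insert a I)
  have "(\<Oplus>i\<in>insert a I. \<Oplus>j\<in>J. f i j) = (\<Oplus>j\<in>J. f a j) \<oplus> (\<Oplus>i\<in>I. \<Oplus>j\<in>J. f i j)"
    using insert by (intro finsum_insert) auto
  also have "(\<Oplus>i\<in>I. \<Oplus>j\<in>J. f i j) = (\<Oplus>j\<in>J. \<Oplus>i\<in>I. f i j)"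
    using insert by simp
  also have "(\<Oplus>j\<in>J. f a j) \<oplus> \<dots> = (\<Oplus>j\<in>J. f a j \<oplus> (\<Oplus>i\<in>I. f i j))"
    using insert by (intro finsum_addf[symmetric]) auto
  also have "\<dots> = (\<Oplus>j\<in>J. \<Oplus>i\<in>insert a I. f i j)"
    using insert by (intro finsum_cong' refl finsum_insert[symmetric]) auto
  finally show ?case .
qed

text \<open>Regroups the pairs with i + j at most n from diagonals to rows, for the associativity of
  the skew product. In the induction step each row i \<le> n gains the single term
  \<open>f i (Suc n - i)\<close>; together with the one-term row \<open>Suc n\<close> these form the
  new diagonal.\<close>

lemma (in abelian_monoid) finsum_triangle:
  fixes f :: "nat \<Rightarrow> nat \<Rightarrow> 'a"
  assumes f: "\<And>i j. f i j \<in> carrier G"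
  shows "(\<Oplus>k\<in>{..n}. \<Oplus>i\<in>{..k}. f i (k - i)) = (\<Oplus>i\<in>{..n}. \<Oplus>j\<in>{..n - i}. f i j)"
proof (induction n)
  case 0
  then show ?case using f by simp
next
  case (Suc n)
  have "(\<Oplus>i\<in>{..n}. \<Oplus>j\<in>{..Suc n - i}. f i j)
      = (\<Oplus>i\<in>{..n}. f i (Suc n - i) \<oplus> (\<Oplus>j\<in>{..n - i}. f i j))"
    using f by (intro finsum_cong') (auto simp: Suc_diff_le)
  also have "\<dots> = (\<Oplus>i\<in>{..n}. f i (Suc n - i)) \<oplus> (\<Oplus>i\<in>{..n}. \<Oplus>j\<in>{..n - i}. f i j)"
    using f by (intro finsum_addf) auto
  finally show ?case using f Suc by (simp add: Pi_def a_assoc)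
qed


section \<open>Algebras over a field\<close>

lemma with_smult_simps [simp]:
  "carrier (with_smult R s) = carrier R"
  "x \<otimes>\<^bsub>with_smult R s\<^esub> y = x \<otimes>\<^bsub>R\<^esub> y"
  "x \<oplus>\<^bsub>with_smult R s\<^esub> y = x \<oplus>\<^bsub>R\<^esub> y"
  "\<one>\<^bsub>with_smult R s\<^esub> = \<one>\<^bsub>R\<^esub>"
  "\<zero>\<^bsub>with_smult R s\<^esub> = \<zero>\<^bsub>R\<^esub>"
  "k \<odot>\<^bsub>with_smult R s\<^esub> x = s k x"
  by (simp_all add: with_smult_def)

text \<open>A finite sum reads only carrier, addition and zero. As an equality of functions this
  rewrites sums inside matrix products and traces, so the ring results carry over to
  algebras.\<close>

lemma finsum_with_smult [simp]: "finsum (with_smult R s) = finsum R"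
  by (simp add: finsum_def finprod_def fun_eq_iff with_smult_def)

lemma ring_with_smult:
  assumes "ring R"
  shows "ring (with_smult R s)"
proof -
  interpret ring R by (rule assms)
  show ?thesis
  proof (rule ringI)
    show "abelian_group (with_smult R s)"
      by (rule abelian_groupI) (auto simp: a_ac intro!: bexI[of _ "\<ominus>\<^bsub>R\<^esub> x" for x] l_neg)
    show "Group.monoid (with_smult R s)"
      by (rule monoidI) (auto simp: m_assoc)
  qed (auto simp: l_distr r_distr)
qed

lemma nc_algebra_with_smultI:
  fixes K (structure) and R (structure)
  assumes "cring K" "ring R"
    and "\<And>k x. k \<in> carrier K \<Longrightarrow> x \<in> carrier R \<Longrightarrow> s k x \<in> carrier R"
    and "\<And>k l x. k \<in> carrier K \<Longrightarrow> l \<in> carrier K \<Longrightarrow> x \<in> carrier R \<Longrightarrow>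
      s (k \<oplus>\<^bsub>K\<^esub> l) x = s k x \<oplus>\<^bsub>R\<^esub> s l x"
    and "\<And>k x y. k \<in> carrier K \<Longrightarrow> x \<in> carrier R \<Longrightarrow> y \<in> carrier R \<Longrightarrow>
      s k (x \<oplus>\<^bsub>R\<^esub> y) = s k x \<oplus>\<^bsub>R\<^esub> s k y"
    and "\<And>k l x. k \<in> carrier K \<Longrightarrow> l \<in> carrier K \<Longrightarrow> x \<in> carrier R \<Longrightarrow>
      s (k \<otimes>\<^bsub>K\<^esub> l) x = s k (s l x)"
    and "\<And>x. x \<in> carrier R \<Longrightarrow> s \<one>\<^bsub>K\<^esub> x = x"
    and "\<And>k x y. k \<in> carrier K \<Longrightarrow> x \<in> carrier R \<Longrightarrow> y \<in> carrier R \<Longrightarrow>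
      s k (x \<otimes>\<^bsub>R\<^esub> y) = s k x \<otimes>\<^bsub>R\<^esub> y"
    and "\<And>k x y. k \<in> carrier K \<Longrightarrow> x \<in> carrier R \<Longrightarrow> y \<in> carrier R \<Longrightarrow>
      s k (x \<otimes>\<^bsub>R\<^esub> y) = x \<otimes>\<^bsub>R\<^esub> s k y"
  shows "nc_algebra K (with_smult R s)"
proof (intro nc_algebra.intro nc_algebra_axioms.intro moduleI)
  show "ring (with_smult R s)"
    by (rule ring_with_smult) fact
  then show "abelian_group (with_smult R s)"
    by (rule ring.is_abelian_group)
qed (use assms in auto)

text \<open>\<open>quot_smult\<close> is a union over all representatives. Two of them differ by an
  element of \<open>I\<close>, which the additive map \<open>s k\<close> keeps in \<open>I\<close>,
  so every member of the union is the same coset; \<open>x\<close> itself shows that the union is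
  not empty.\<close>

lemma (in ring) quot_smult_coset:
  assumes I: "ideal I R" and x: "x \<in> carrier R"
    and closed: "\<And>a. a \<in> carrier R \<Longrightarrow> s k a \<in> carrier R"
    and add: "\<And>a b. a \<in> carrier R \<Longrightarrow> b \<in> carrier R \<Longrightarrow> s k (a \<oplus> b) = s k a \<oplus> s k b"
    and sI: "\<And>a. a \<in> I \<Longrightarrow> s k a \<in> I"
  shows "quot_smult R I s k (I +> x) = I +> s k x"
proof -
  interpret ideal I R by (rule I)
  have "I +> s k a = I +> s k x" if a: "a \<in> I +> x" for a
  proof -
    obtain h where h: "h \<in> I" "a = h \<oplus> x"
      using a by (auto simp: a_r_coset_def')
    then have "s k a \<in> I +> s k x"
      using x sI by (auto simp: a_r_coset_def' add)
    then show ?thesis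
      using a_repr_independence'[of "s k a" "s k x"] closed[OF x] by simp
  qed
  moreover have "x \<in> I +> x"
    using x by (rule a_rcos_self)
  ultimately show ?thesis
    unfolding quot_smult_def by blast
qed

lemma FactRing_carrierE:
  assumes "X \<in> carrier (R Quot I)"
  obtains x where "x \<in> carrier R" "X = I +>\<^bsub>R\<^esub> x"
  using assms by (auto simp: FactRing_simps)

lemma (in ideal) FactRing_coset_simps:
  "x \<in> carrier R \<Longrightarrow> I +> x \<in> carrier (R Quot I)"
  "x \<in> carrier R \<Longrightarrow> y \<in> carrier R \<Longrightarrow> (I +> x) \<otimes>\<^bsub>R Quot I\<^esub> (I +> y) = I +> (x \<otimes> y)"
  "x \<in> carrier R \<Longrightarrow> y \<in> carrier R \<Longrightarrow> (I +> x) \<oplus>\<^bsub>R Quot I\<^esub> (I +> y) = I +> (x \<oplus> y)"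
  "\<one>\<^bsub>R Quot I\<^esub> = I +> \<one>"
  "\<zero>\<^bsub>R Quot I\<^esub> = I +> \<zero>"
  by (auto simp: FactRing_simps rcoset_mult_add a_rcos_sum a_rcos_zero[OF is_ideal])

lemma nc_algebra_quot:
  assumes alg: "nc_algebra K (with_smult R s)" and I: "ideal I R"
    and sI: "\<And>k a. k \<in> carrier K \<Longrightarrow> a \<in> I \<Longrightarrow> s k a \<in> I"
  shows "nc_algebra K (with_smult (R Quot I) (quot_smult R I s))"
proof -
  interpret S: nc_algebra K "with_smult R s" by (rule alg)
  interpret ideal I R by (rule I)
  note S.smult_closed [simplified, simp]
  have q: "quot_smult R I s k (I +>\<^bsub>R\<^esub> x) = I +>\<^bsub>R\<^esub> s k x"
    if "k \<in> carrier K" "x \<in> carrier R" for k x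
    using that sI S.smult_r_distr by (intro quot_smult_coset I) auto
  show ?thesis
  proof (rule nc_algebra_with_smultI)
    show "cring K" by (rule S.R.is_cring)
    show "ring (R Quot I)" by (rule quotient_is_ring)
  qed (use S.smult_l_distr S.smult_r_distr S.smult_assoc1 S.smult_one
         S.smult_mult_left S.smult_mult_right in
       \<open>auto elim!: FactRing_carrierE simp: q FactRing_coset_simps simp del: S.smult_one\<close>)
qed


section \<open>Matrix rings\<close>

lemma matrix_ring_simps:
  "M \<in> carrier (matrix_ring n S) \<longleftrightarrow>
    M \<in> carrier_mat n n \<and> (\<forall>i<n. \<forall>j<n. M $$ (i, j) \<in> carrier S)"
  "M \<otimes>\<^bsub>matrix_ring n S\<^esub> N
    = mat n n (\<lambda>(i, j). \<Oplus>\<^bsub>S\<^esub>k\<in>{..<n}. M $$ (i, k) \<otimes>\<^bsub>S\<^esub> N $$ (k, j))"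
  "\<one>\<^bsub>matrix_ring n S\<^esub> = mat n n (\<lambda>(i, j). if i = j then \<one>\<^bsub>S\<^esub> else \<zero>\<^bsub>S\<^esub>)"
  "\<zero>\<^bsub>matrix_ring n S\<^esub> = mat n n (\<lambda>(i, j). \<zero>\<^bsub>S\<^esub>)"
  "M \<oplus>\<^bsub>matrix_ring n S\<^esub> N = mat n n (\<lambda>(i, j). M $$ (i, j) \<oplus>\<^bsub>S\<^esub> N $$ (i, j))"
  by (simp_all add: matrix_ring_def)

lemma matrix_ring_with_smult [simp]: "matrix_ring n (with_smult S s) = matrix_ring n S"
  by (simp add: matrix_ring_def cong: if_cong)

lemma (in ring) matrix_ring_is_ring: "ring (matrix_ring n R)"
proof (rule ringI)
  show "abelian_group (matrix_ring n R)"
  proof (rule abelian_groupI)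
    fix M assume M: "M \<in> carrier (matrix_ring n R)"
    show "\<exists>N\<in>carrier (matrix_ring n R). N \<oplus>\<^bsub>matrix_ring n R\<^esub> M = \<zero>\<^bsub>matrix_ring n R\<^esub>"
      by (rule bexI[of _ "mat n n (\<lambda>ij. \<ominus> (M $$ ij))"])
        (use M in \<open>auto simp: matrix_ring_simps l_neg intro!: eq_matI\<close>)
  qed (auto simp: matrix_ring_simps a_ac intro!: eq_matI)
next
  \<comment> \<open>A row or column of the identity matrix acts as a Kronecker delta, leaving one
    summand.\<close>
  have one_mat_sum:
    "(\<Oplus>k\<in>{..<n}. \<one>\<^bsub>matrix_ring n R\<^esub> $$ (i, k) \<otimes> f k) = f i"
    "(\<Oplus>k\<in>{..<n}. f k \<otimes> \<one>\<^bsub>matrix_ring n R\<^esub> $$ (k, i)) = f i"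
    if "i < n" "\<And>k. k < n \<Longrightarrow> f k \<in> carrier R" for i and f :: "nat \<Rightarrow> 'a"
  proof -
    have "(\<Oplus>k\<in>{..<n}. \<one>\<^bsub>matrix_ring n R\<^esub> $$ (i, k) \<otimes> f k)
        = (\<Oplus>k\<in>{..<n}. if i = k then f k else \<zero>)"
      using that by (intro finsum_cong') (auto simp: matrix_ring_simps)
    also have "\<dots> = f i"
      using that by (intro finsum_singleton) auto
    finally show "(\<Oplus>k\<in>{..<n}. \<one>\<^bsub>matrix_ring n R\<^esub> $$ (i, k) \<otimes> f k) = f i" .
    have "(\<Oplus>k\<in>{..<n}. f k \<otimes> \<one>\<^bsub>matrix_ring n R\<^esub> $$ (k, i))
        = (\<Oplus>k\<in>{..<n}. if i = k then f k else \<zero>)"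
      using that by (intro finsum_cong') (auto simp: matrix_ring_simps)
    also have "\<dots> = f i"
      using that by (intro finsum_singleton) auto
    finally show "(\<Oplus>k\<in>{..<n}. f k \<otimes> \<one>\<^bsub>matrix_ring n R\<^esub> $$ (k, i)) = f i" .
  qed
  show "Group.monoid (matrix_ring n R)"
  proof (rule monoidI)
    fix L M N
    assume LMN: "L \<in> carrier (matrix_ring n R)" "M \<in> carrier (matrix_ring n R)"
      "N \<in> carrier (matrix_ring n R)"
    show "L \<otimes>\<^bsub>matrix_ring n R\<^esub> M \<otimes>\<^bsub>matrix_ring n R\<^esub> N
        = L \<otimes>\<^bsub>matrix_ring n R\<^esub> (M \<otimes>\<^bsub>matrix_ring n R\<^esub> N)"
    proof (rule eq_matI, goal_cases)
      case (1 i j)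
      then have ij: "i < n" "j < n"
        by (auto simp: matrix_ring_simps)
      have "(\<Oplus>k\<in>{..<n}. (L \<otimes>\<^bsub>matrix_ring n R\<^esub> M) $$ (i, k) \<otimes> N $$ (k, j))
          = (\<Oplus>k\<in>{..<n}. \<Oplus>l\<in>{..<n}. L $$ (i, l) \<otimes> M $$ (l, k) \<otimes> N $$ (k, j))"
        using LMN ij by (intro finsum_cong') (auto simp: matrix_ring_simps finsum_ldistr Pi_def)
      also have "\<dots> = (\<Oplus>l\<in>{..<n}. \<Oplus>k\<in>{..<n}. L $$ (i, l) \<otimes> M $$ (l, k) \<otimes> N $$ (k, j))"
        using LMN ij by (intro finsum_swap) (auto simp: matrix_ring_simps)
      also have "\<dots> = (\<Oplus>l\<in>{..<n}. \<Oplus>k\<in>{..<n}. L $$ (i, l) \<otimes> (M $$ (l, k) \<otimes> N $$ (k, j)))"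
        using LMN ij by (intro finsum_cong' refl) (auto simp: matrix_ring_simps m_assoc)
      also have "\<dots> = (\<Oplus>l\<in>{..<n}. L $$ (i, l) \<otimes> (M \<otimes>\<^bsub>matrix_ring n R\<^esub> N) $$ (l, j))"
        using LMN ij by (intro finsum_cong') (auto simp: matrix_ring_simps finsum_rdistr Pi_def)
      finally show ?case
        using ij by (simp add: matrix_ring_simps(2)[of n R _ N] matrix_ring_simps(2)[of n R L])
    qed (auto simp: matrix_ring_simps)
  next
    fix M assume M: "M \<in> carrier (matrix_ring n R)"
    have prod_entry: "(X \<otimes>\<^bsub>matrix_ring n R\<^esub> Y) $$ (i, j) = (\<Oplus>k\<in>{..<n}. X $$ (i, k) \<otimes> Y $$ (k, j))"
      if "i < n" "j < n" for X Y i j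
      using that by (simp add: matrix_ring_simps(2))
    show "\<one>\<^bsub>matrix_ring n R\<^esub> \<otimes>\<^bsub>matrix_ring n R\<^esub> M = M"
      by (rule eq_matI) (use M in \<open>auto simp: matrix_ring_simps(1) prod_entry one_mat_sum\<close>,
          auto simp: matrix_ring_simps)
    show "M \<otimes>\<^bsub>matrix_ring n R\<^esub> \<one>\<^bsub>matrix_ring n R\<^esub> = M"
      by (rule eq_matI) (use M in \<open>auto simp: matrix_ring_simps(1) prod_entry one_mat_sum\<close>,
          auto simp: matrix_ring_simps)
  qed (auto simp: matrix_ring_simps intro!: finsum_closed)
next
  fix L M N
  assume LMN: "L \<in> carrier (matrix_ring n R)" "M \<in> carrier (matrix_ring n R)"
    "N \<in> carrier (matrix_ring n R)"
  show "(L \<oplus>\<^bsub>matrix_ring n R\<^esub> M) \<otimes>\<^bsub>matrix_ring n R\<^esub> N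
      = L \<otimes>\<^bsub>matrix_ring n R\<^esub> N \<oplus>\<^bsub>matrix_ring n R\<^esub> M \<otimes>\<^bsub>matrix_ring n R\<^esub> N"
  proof (rule eq_matI, goal_cases)
    case (1 i j)
    then have ij: "i < n" "j < n"
      by (auto simp: matrix_ring_simps)
    have "(\<Oplus>k\<in>{..<n}. (L $$ (i, k) \<oplus> M $$ (i, k)) \<otimes> N $$ (k, j))
        = (\<Oplus>k\<in>{..<n}. L $$ (i, k) \<otimes> N $$ (k, j) \<oplus> M $$ (i, k) \<otimes> N $$ (k, j))"
      using LMN ij by (intro finsum_cong') (auto simp: matrix_ring_simps l_distr)
    also have "\<dots> = (\<Oplus>k\<in>{..<n}. L $$ (i, k) \<otimes> N $$ (k, j)) \<oplus> (\<Oplus>k\<in>{..<n}. M $$ (i, k) \<otimes> N $$ (k, j))"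
      using LMN ij by (intro finsum_addf) (auto simp: matrix_ring_simps)
    finally show ?case
      using ij LMN by (simp add: matrix_ring_simps cong: finsum_cong)
  qed (auto simp: matrix_ring_simps)
  show "N \<otimes>\<^bsub>matrix_ring n R\<^esub> (L \<oplus>\<^bsub>matrix_ring n R\<^esub> M)
      = N \<otimes>\<^bsub>matrix_ring n R\<^esub> L \<oplus>\<^bsub>matrix_ring n R\<^esub> N \<otimes>\<^bsub>matrix_ring n R\<^esub> M"
  proof (rule eq_matI, goal_cases)
    case (1 i j)
    then have ij: "i < n" "j < n"
      by (auto simp: matrix_ring_simps)
    have "(\<Oplus>k\<in>{..<n}. N $$ (i, k) \<otimes> (L $$ (k, j) \<oplus> M $$ (k, j)))
        = (\<Oplus>k\<in>{..<n}. N $$ (i, k) \<otimes> L $$ (k, j) \<oplus> N $$ (i, k) \<otimes> M $$ (k, j))"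
      using LMN ij by (intro finsum_cong') (auto simp: matrix_ring_simps r_distr)
    also have "\<dots> = (\<Oplus>k\<in>{..<n}. N $$ (i, k) \<otimes> L $$ (k, j)) \<oplus> (\<Oplus>k\<in>{..<n}. N $$ (i, k) \<otimes> M $$ (k, j))"
      using LMN ij by (intro finsum_addf) (auto simp: matrix_ring_simps)
    finally show ?case
      using ij LMN by (simp add: matrix_ring_simps cong: finsum_cong)
  qed (auto simp: matrix_ring_simps)
qed

lemma nc_algebra_matrix_alg:
  assumes "nc_algebra K S"
  shows "nc_algebra K (matrix_alg n S)"
proof -
  interpret S: nc_algebra K S by (rule assms)
  have dist: "k \<odot>\<^bsub>S\<^esub> (\<Oplus>\<^bsub>S\<^esub>l\<in>{..<n}. f l \<otimes>\<^bsub>S\<^esub> g l) = (\<Oplus>\<^bsub>S\<^esub>l\<in>{..<n}. k \<odot>\<^bsub>S\<^esub> (f l \<otimes>\<^bsub>S\<^esub> g l))"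
    if "k \<in> carrier K" "\<And>l. l < n \<Longrightarrow> f l \<in> carrier S" "\<And>l. l < n \<Longrightarrow> g l \<in> carrier S" for k f g
    using that by (intro S.finsum_smult_ldistr) auto
  show ?thesis
    unfolding matrix_alg_def
  proof (rule nc_algebra_with_smultI, goal_cases)
    case (8 k M N)
    then show ?case
      by (auto simp: matrix_ring_simps dist S.smult_mult_left
          intro!: eq_matI S.M.finsum_cong')
  next
    case (9 k M N)
    then show ?case
      by (auto simp: matrix_ring_simps dist S.smult_mult_right
          intro!: eq_matI S.M.finsum_cong')
  qed (auto simp: S.R.is_cring S.A.matrix_ring_is_ring matrix_ring_simps
      S.smult_l_distr S.smult_r_distr S.smult_assoc1 intro!: eq_matI)
qed


section \<open>Truncation of skew polynomial rings\<close>

text \<open>Both \<open>skew_poly R \<sigma>\<close> and, for \<open>\<sigma> = id\<close>, the library ring \<open>UP R\<close> are of this shape. They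
  differ in the record type and in the behaviour of the operations outside the carrier.\<close>

locale skew_poly_ring = ring R for R (structure) +
  fixes \<sigma> :: "'a \<Rightarrow> 'a" and P :: "(nat \<Rightarrow> 'a, 'q) ring_scheme"
  assumes hom: "\<sigma> \<in> Ring.ring_hom R R"
    and carrier_P: "carrier P = up R"
    and one_P: "\<one>\<^bsub>P\<^esub> = (\<lambda>i. if i = 0 then \<one> else \<zero>)"
    and zero_P: "\<zero>\<^bsub>P\<^esub> = (\<lambda>i. \<zero>)"
    and add_P: "p \<in> up R \<Longrightarrow> q \<in> up R \<Longrightarrow> p \<oplus>\<^bsub>P\<^esub> q = (\<lambda>i. p i \<oplus> q i)"
    and mult_P: "p \<in> up R \<Longrightarrow> q \<in> up R \<Longrightarrow>
      p \<otimes>\<^bsub>P\<^esub> q = (\<lambda>n. \<Oplus>i\<in>{..n}. p i \<otimes> (\<sigma> ^^ i) (q (n - i)))"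
begin

section \<open>Powers of the endomorphism\<close>

lemma hom_pow: "\<sigma> ^^ n \<in> Ring.ring_hom R R"
proof (induction n)
  case (Suc n)
  then show ?case
    using hom by (auto intro!: ring_hom_memI simp: ring_hom_closed ring_hom_mult ring_hom_add ring_hom_one)
qed (auto intro: ring_hom_memI)

lemma hom_pow_simps [simp]:
  "x \<in> carrier R \<Longrightarrow> (\<sigma> ^^ n) x \<in> carrier R"
  "x \<in> carrier R \<Longrightarrow> y \<in> carrier R \<Longrightarrow> (\<sigma> ^^ n) (x \<oplus> y) = (\<sigma> ^^ n) x \<oplus> (\<sigma> ^^ n) y"
  "x \<in> carrier R \<Longrightarrow> y \<in> carrier R \<Longrightarrow> (\<sigma> ^^ n) (x \<otimes> y) = (\<sigma> ^^ n) x \<otimes> (\<sigma> ^^ n) y"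
  "(\<sigma> ^^ n) \<one> = \<one>" "(\<sigma> ^^ n) \<zero> = \<zero>"
  using hom_pow[of n] ring_hom_zero[OF hom_pow ring_axioms ring_axioms, of n]
  by (auto simp: ring_hom_def)

lemma hom_pow_finsum:
  assumes "finite I" "f \<in> I \<rightarrow> carrier R"
  shows "(\<sigma> ^^ n) (\<Oplus>i\<in>I. f i) = (\<Oplus>i\<in>I. (\<sigma> ^^ n) (f i))"
  using assms
proof (induction I rule: finite_induct)
  case (insert i I)
  then have "(\<Oplus>j\<in>insert i I. f j) = f i \<oplus> (\<Oplus>j\<in>I. f j)"
    and "(\<Oplus>j\<in>insert i I. (\<sigma> ^^ n) (f j)) = (\<sigma> ^^ n) (f i) \<oplus> (\<Oplus>j\<in>I. (\<sigma> ^^ n) (f j))"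
    by (auto simp: Pi_def intro!: finsum_insert)
  with insert show ?case by simp
qed simp

section \<open>Ring structure on skew polynomials\<close>

lemma up_coeff [simp]: "p \<in> up R \<Longrightarrow> p i \<in> carrier R"
  by (rule mem_upD)

text \<open>If m and l bound the degrees of the factors and n > m + l, every summand vanishes:
  either i > m, or n - i > l.\<close>

lemma skew_mult_closed:
  assumes p: "p \<in> up R" and q: "q \<in> up R"
  shows "(\<lambda>n. \<Oplus>i\<in>{..n}. p i \<otimes> (\<sigma> ^^ i) (q (n - i))) \<in> up R"
proof (rule mem_upI)
  show "(\<Oplus>i\<in>{..n}. p i \<otimes> (\<sigma> ^^ i) (q (n - i))) \<in> carrier R" for n
    using p q by (intro finsum_closed) auto
next
  obtain m where m: "bound \<zero> m p" using bound_upD[OF p] by blast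
  obtain l where l: "bound \<zero> l q" using bound_upD[OF q] by blast
  have "bound \<zero> (m + l) (\<lambda>n. \<Oplus>i\<in>{..n}. p i \<otimes> (\<sigma> ^^ i) (q (n - i)))"
  proof
    fix n assume n: "m + l < n"
    have "p i \<otimes> (\<sigma> ^^ i) (q (n - i)) = \<zero>" for i
    proof (cases "m < i")
      case True
      then have "p i = \<zero>" by (rule bound.bound[OF m])
      then show ?thesis using q by simp
    next
      case False
      then have "q (n - i) = \<zero>" using n by (intro bound.bound[OF l]) simp
      then show ?thesis using p by simp
    qed
    then show "(\<Oplus>i\<in>{..n}. p i \<otimes> (\<sigma> ^^ i) (q (n - i))) = \<zero>"
      by (simp add: finsum_zero)
  qed
  then show "\<exists>n. bound \<zero> n (\<lambda>n. \<Oplus>i\<in>{..n}. p i \<otimes> (\<sigma> ^^ i) (q (n - i)))" by blast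
qed

lemma up_closed_P:
  "(\<lambda>i. \<zero>) \<in> up R" "p \<in> up R \<Longrightarrow> q \<in> up R \<Longrightarrow> p \<oplus>\<^bsub>P\<^esub> q \<in> up R"
  "p \<in> up R \<Longrightarrow> q \<in> up R \<Longrightarrow> p \<otimes>\<^bsub>P\<^esub> q \<in> up R"
  by (auto simp: add_P mult_P up_add_closed skew_mult_closed intro!: mem_upI)

text \<open>Both sides have as n-th coefficient the sum of \<open>p i \<otimes> (\<sigma> ^^ i) (q
  j) \<otimes> (\<sigma> ^^ (i + j)) (r (n - (i + j)))\<close> over i + j \<le> n. The left side
  groups by k = i + j, the right side by i; \<open>finsum_triangle\<close> passes between them.
  Moving \<sigma>^i into the inner product uses that it is a ring homomorphism.\<close>

lemma skew_mult_assoc: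
  assumes pqr: "p \<in> up R" "q \<in> up R" "r \<in> up R"
  shows "p \<otimes>\<^bsub>P\<^esub> q \<otimes>\<^bsub>P\<^esub> r = p \<otimes>\<^bsub>P\<^esub> (q \<otimes>\<^bsub>P\<^esub> r)"
proof
  fix n
  let ?f = "\<lambda>i j. p i \<otimes> (\<sigma> ^^ i) (q j) \<otimes> (\<sigma> ^^ (i + j)) (r (n - (i + j)))"
  have "(p \<otimes>\<^bsub>P\<^esub> q \<otimes>\<^bsub>P\<^esub> r) n
      = (\<Oplus>k\<in>{..n}. (\<Oplus>i\<in>{..k}. p i \<otimes> (\<sigma> ^^ i) (q (k - i))) \<otimes> (\<sigma> ^^ k) (r (n - k)))"
    using pqr by (simp add: mult_P skew_mult_closed)
  also have "\<dots> = (\<Oplus>k\<in>{..n}. \<Oplus>i\<in>{..k}. ?f i (k - i))"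
  proof (rule finsum_cong')
    fix k
    have "(\<Oplus>i\<in>{..k}. p i \<otimes> (\<sigma> ^^ i) (q (k - i))) \<otimes> (\<sigma> ^^ k) (r (n - k))
        = (\<Oplus>i\<in>{..k}. p i \<otimes> (\<sigma> ^^ i) (q (k - i)) \<otimes> (\<sigma> ^^ k) (r (n - k)))"
      using pqr by (intro finsum_ldistr) auto
    also have "\<dots> = (\<Oplus>i\<in>{..k}. ?f i (k - i))"
      using pqr by (intro finsum_cong') auto
    finally show "(\<Oplus>i\<in>{..k}. p i \<otimes> (\<sigma> ^^ i) (q (k - i))) \<otimes> (\<sigma> ^^ k) (r (n - k))
      = (\<Oplus>i\<in>{..k}. ?f i (k - i))" .
  qed (use pqr in \<open>auto intro!: finsum_closed\<close>)
  also have "\<dots> = (\<Oplus>i\<in>{..n}. \<Oplus>j\<in>{..n - i}. ?f i j)"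
    using pqr by (intro finsum_triangle) auto
  also have "\<dots> = (\<Oplus>i\<in>{..n}. p i \<otimes> (\<sigma> ^^ i) (\<Oplus>j\<in>{..n - i}. q j \<otimes> (\<sigma> ^^ j) (r (n - i - j))))"
  proof (rule finsum_cong')
    fix i
    have "p i \<otimes> (\<sigma> ^^ i) (\<Oplus>j\<in>{..n - i}. q j \<otimes> (\<sigma> ^^ j) (r (n - i - j)))
        = p i \<otimes> (\<Oplus>j\<in>{..n - i}. (\<sigma> ^^ i) (q j \<otimes> (\<sigma> ^^ j) (r (n - i - j))))"
      using pqr by (subst hom_pow_finsum) auto
    also have "\<dots> = (\<Oplus>j\<in>{..n - i}. p i \<otimes> (\<sigma> ^^ i) (q j \<otimes> (\<sigma> ^^ j) (r (n - i - j))))"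
      using pqr by (intro finsum_rdistr) auto
    also have "\<dots> = (\<Oplus>j\<in>{..n - i}. ?f i j)"
      using pqr by (intro finsum_cong') (auto simp: m_assoc funpow_add)
    finally show "(\<Oplus>j\<in>{..n - i}. ?f i j)
        = p i \<otimes> (\<sigma> ^^ i) (\<Oplus>j\<in>{..n - i}. q j \<otimes> (\<sigma> ^^ j) (r (n - i - j)))" ..
  qed (use pqr in \<open>auto intro!: m_closed hom_pow_simps(1) finsum_closed\<close>)
  also have "\<dots> = (p \<otimes>\<^bsub>P\<^esub> (q \<otimes>\<^bsub>P\<^esub> r)) n"
    using pqr by (simp add: mult_P skew_mult_closed)
  finally show "(p \<otimes>\<^bsub>P\<^esub> q \<otimes>\<^bsub>P\<^esub> r) n = (p \<otimes>\<^bsub>P\<^esub> (q \<otimes>\<^bsub>P\<^esub> r)) n" .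
qed

sublocale P: ring P
proof (rule ringI)
  show "abelian_group P"
  proof (rule abelian_groupI)
    show "\<exists>q\<in>carrier P. q \<oplus>\<^bsub>P\<^esub> p = \<zero>\<^bsub>P\<^esub>" if "p \<in> carrier P" for p
      by (rule bexI[of _ "\<lambda>i. \<ominus> p i"])
        (use that in \<open>auto simp: carrier_P add_P zero_P up_a_inv_closed l_neg\<close>)
  qed (auto simp: carrier_P up_closed_P zero_P add_P up_add_closed a_ac)
  show "Group.monoid P"
  proof (rule monoidI)
    fix p assume p: "p \<in> carrier P"
    show "\<one>\<^bsub>P\<^esub> \<otimes>\<^bsub>P\<^esub> p = p"
    proof
      fix n
      have "(\<one>\<^bsub>P\<^esub> \<otimes>\<^bsub>P\<^esub> p) n = (\<Oplus>i\<in>{..n}. if 0 = i then p n else \<zero>)"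
        using p by (auto simp: carrier_P one_P up_one_closed mult_P intro!: finsum_cong')
      also have "\<dots> = p n"
        using p finsum_singleton[of 0 "{..n}" "\<lambda>_. p n"] by (auto simp: carrier_P)
      finally show "(\<one>\<^bsub>P\<^esub> \<otimes>\<^bsub>P\<^esub> p) n = p n" .
    qed
    show "p \<otimes>\<^bsub>P\<^esub> \<one>\<^bsub>P\<^esub> = p"
    proof
      fix n
      \<comment> \<open>Only i = n meets the constant coefficient of the right factor, and
        \<sigma>^n fixes 1.\<close>
      have "(p \<otimes>\<^bsub>P\<^esub> \<one>\<^bsub>P\<^esub>) n = (\<Oplus>i\<in>{..n}. if n = i then p n else \<zero>)"
        using p by (auto simp: carrier_P one_P up_one_closed mult_P intro!: finsum_cong')
      also have "\<dots> = p n"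
        using p finsum_singleton[of n "{..n}" "\<lambda>_. p n"] by (auto simp: carrier_P)
      finally show "(p \<otimes>\<^bsub>P\<^esub> \<one>\<^bsub>P\<^esub>) n = p n" .
    qed
  qed (auto simp: carrier_P up_closed_P one_P up_one_closed skew_mult_assoc)
next
  fix p q r assume "p \<in> carrier P" "q \<in> carrier P" "r \<in> carrier P"
  then have pqr: "p \<in> up R" "q \<in> up R" "r \<in> up R"
    by (simp_all add: carrier_P)
  show "(p \<oplus>\<^bsub>P\<^esub> q) \<otimes>\<^bsub>P\<^esub> r = p \<otimes>\<^bsub>P\<^esub> r \<oplus>\<^bsub>P\<^esub> q \<otimes>\<^bsub>P\<^esub> r"
  proof
    fix n
    have "((p \<oplus>\<^bsub>P\<^esub> q) \<otimes>\<^bsub>P\<^esub> r) n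
        = (\<Oplus>i\<in>{..n}. p i \<otimes> (\<sigma> ^^ i) (r (n - i)) \<oplus> q i \<otimes> (\<sigma> ^^ i) (r (n - i)))"
      using pqr by (auto simp: mult_P add_P up_add_closed l_distr intro!: finsum_cong')
    also have "\<dots> = (p \<otimes>\<^bsub>P\<^esub> r \<oplus>\<^bsub>P\<^esub> q \<otimes>\<^bsub>P\<^esub> r) n"
      using pqr by (auto simp: mult_P add_P skew_mult_closed intro!: finsum_addf)
    finally show "((p \<oplus>\<^bsub>P\<^esub> q) \<otimes>\<^bsub>P\<^esub> r) n = (p \<otimes>\<^bsub>P\<^esub> r \<oplus>\<^bsub>P\<^esub> q \<otimes>\<^bsub>P\<^esub> r) n" .
  qed
  show "r \<otimes>\<^bsub>P\<^esub> (p \<oplus>\<^bsub>P\<^esub> q) = r \<otimes>\<^bsub>P\<^esub> p \<oplus>\<^bsub>P\<^esub> r \<otimes>\<^bsub>P\<^esub> q"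
  proof
    fix n
    have "(r \<otimes>\<^bsub>P\<^esub> (p \<oplus>\<^bsub>P\<^esub> q)) n
        = (\<Oplus>i\<in>{..n}. r i \<otimes> (\<sigma> ^^ i) (p (n - i)) \<oplus> r i \<otimes> (\<sigma> ^^ i) (q (n - i)))"
      using pqr by (auto simp: mult_P add_P up_add_closed r_distr intro!: finsum_cong')
    also have "\<dots> = (r \<otimes>\<^bsub>P\<^esub> p \<oplus>\<^bsub>P\<^esub> r \<otimes>\<^bsub>P\<^esub> q) n"
      using pqr by (auto simp: mult_P add_P skew_mult_closed intro!: finsum_addf)
    finally show "(r \<otimes>\<^bsub>P\<^esub> (p \<oplus>\<^bsub>P\<^esub> q)) n = (r \<otimes>\<^bsub>P\<^esub> p \<oplus>\<^bsub>P\<^esub> r \<otimes>\<^bsub>P\<^esub> q) n" .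
  qed
qed

lemma a_inv_P: "p \<in> up R \<Longrightarrow> \<ominus>\<^bsub>P\<^esub> p = (\<lambda>i. \<ominus> p i)"
  by (rule P.minus_equality) (auto simp: carrier_P add_P zero_P up_a_inv_closed l_neg)

section \<open>Monomials\<close>

lemma skew_monom_closed [simp]: "a \<in> carrier R \<Longrightarrow> skew_monom R a n \<in> up R"
  by (rule mem_upI) (auto simp: skew_monom_def bound_def intro!: exI[of _ n])

lemma skew_monom_mult_P:
  assumes "a \<in> carrier R" "b \<in> carrier R"
  shows "skew_monom R a m \<otimes>\<^bsub>P\<^esub> skew_monom R b n = skew_monom R (a \<otimes> (\<sigma> ^^ m) b) (m + n)"
  using skew_monom_mult[OF ring_axioms hom assms] assms
  by (simp add: mult_P skew_poly_def)

text \<open>Since \<sigma> fixes 1, multiplying by the variable only raises the degree.\<close>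

lemma skew_monom_pow: "skew_var R [^]\<^bsub>P\<^esub> n = skew_monom R \<one> n"
proof (induction n)
  case 0
  then show ?case by (simp add: one_P skew_monom_def)
next
  case (Suc n)
  then show ?case by (simp add: skew_var_def skew_monom_mult_P)
qed

lemma skew_monom_zero: "skew_monom R \<zero> n = \<zero>\<^bsub>P\<^esub>"
  by (simp add: skew_monom_def zero_P)

lemma skew_monom_add:
  "a \<in> carrier R \<Longrightarrow> b \<in> carrier R \<Longrightarrow>
    skew_monom R a n \<oplus>\<^bsub>P\<^esub> skew_monom R b n = skew_monom R (a \<oplus> b) n"
  by (auto simp: add_P) (auto simp: skew_monom_def)

section \<open>The ideal generated by a power of the variable\<close>

definition low_zero :: "nat \<Rightarrow> (nat \<Rightarrow> 'a) set"
  where "low_zero t = {p \<in> up R. \<forall>i<t. p i = \<zero>}"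

text \<open>For n < t, each summand of the n-th coefficient of a product involves only indices at
  most n of either factor, so a factor in \<open>low_zero t\<close> on either side kills it.\<close>

lemma ideal_low_zero: "ideal (low_zero t) P"
proof (rule idealI)
  show "ring P" ..
  show "subgroup (low_zero t) (add_monoid P)"
  proof (rule P.add.subgroupI)
    show "low_zero t \<noteq> {}"
      using up_closed_P(1) by (auto simp: low_zero_def)
    fix p assume p: "p \<in> low_zero t"
    then show "\<ominus>\<^bsub>P\<^esub> p \<in> low_zero t"
      by (simp add: low_zero_def a_inv_P up_a_inv_closed)
    fix q assume "q \<in> low_zero t"
    with p show "p \<oplus>\<^bsub>P\<^esub> q \<in> low_zero t"
      by (simp add: low_zero_def add_P up_add_closed)
  qed (auto simp: low_zero_def carrier_P)
next
  fix p q assume p: "p \<in> low_zero t" and q: "q \<in> carrier P"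
  have "(\<Oplus>i\<in>{..n}. q i \<otimes> (\<sigma> ^^ i) (p (n - i))) = \<zero>"
       "(\<Oplus>i\<in>{..n}. p i \<otimes> (\<sigma> ^^ i) (q (n - i))) = \<zero>" if "n < t" for n
    using p q that by (auto simp: low_zero_def carrier_P intro!: add.finprod_one_eqI)
  then show "q \<otimes>\<^bsub>P\<^esub> p \<in> low_zero t" "p \<otimes>\<^bsub>P\<^esub> q \<in> low_zero t"
    using p q by (auto simp: low_zero_def carrier_P mult_P skew_mult_closed)
qed

text \<open>An element of \<open>low_zero t\<close> is a left multiple of the monomial: shifting its
  coefficients down by t gives the cofactor, because \<sigma>^i fixes the coefficient 1.\<close>

lemma genideal_monom: "Idl\<^bsub>P\<^esub> {skew_monom R \<one> t} = low_zero t"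
proof
  show "Idl\<^bsub>P\<^esub> {skew_monom R \<one> t} \<subseteq> low_zero t"
    by (rule P.genideal_minimal[OF ideal_low_zero]) (auto simp: low_zero_def, simp add: skew_monom_def)
  interpret I: ideal "Idl\<^bsub>P\<^esub> {skew_monom R \<one> t}" P
    by (rule P.genideal_ideal) (simp add: carrier_P)
  show "low_zero t \<subseteq> Idl\<^bsub>P\<^esub> {skew_monom R \<one> t}"
  proof
    fix p assume p: "p \<in> low_zero t"
    define q where "q = (\<lambda>i. p (i + t))"
    obtain m where "bound \<zero> m p"
      using p bound_upD[of p] by (auto simp: low_zero_def)
    then have "bound \<zero> m q"
      by (auto simp: q_def bound_def)
    then have q: "q \<in> up R"
      using p by (auto simp: low_zero_def q_def)
    have "(q \<otimes>\<^bsub>P\<^esub> skew_monom R \<one> t) n = p n" for n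
    proof -
      have "(q \<otimes>\<^bsub>P\<^esub> skew_monom R \<one> t) n = (\<Oplus>i\<in>{..n}. q i \<otimes> (\<sigma> ^^ i) (skew_monom R \<one> t (n - i)))"
        using q by (simp add: mult_P)
      \<comment> \<open>For n < t the truncated difference n - t is 0; the formula remains correct
        because then \<open>p n\<close> is zero and all summands on the left vanish.\<close>
      also have "\<dots> = (\<Oplus>i\<in>{..n}. if n - t = i then p n else \<zero>)"
        using p q by (intro finsum_cong') (auto simp: skew_monom_def q_def low_zero_def)
      also have "\<dots> = p n"
        using p finsum_singleton[of "n - t" "{..n}" "\<lambda>_. p n"] by (auto simp: low_zero_def)
      finally show ?thesis .
    qed
    then have "p = q \<otimes>\<^bsub>P\<^esub> skew_monom R \<one> t" by auto
    then show "p \<in> Idl\<^bsub>P\<^esub> {skew_monom R \<one> t}"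
      using q by (simp add: I.I_l_closed P.genideal_self' carrier_P)
  qed
qed

text \<open>Both the uniqueness of the representing sequence in \<open>mu\<close> and the
  injectivity of \<open>mu\<close> rest on this criterion.\<close>

lemma low_zero_coset_eq_iff:
  assumes "p \<in> up R" "q \<in> up R"
  shows "low_zero t +>\<^bsub>P\<^esub> p = low_zero t +>\<^bsub>P\<^esub> q \<longleftrightarrow> (\<forall>i<t. p i = q i)"
proof -
  have "low_zero t +>\<^bsub>P\<^esub> p = low_zero t +>\<^bsub>P\<^esub> q \<longleftrightarrow> p \<ominus>\<^bsub>P\<^esub> q \<in> low_zero t"
    using assms P.quotient_eq_iff_same_a_r_cos[OF ideal_low_zero] by (simp add: carrier_P)
  also have "\<dots> \<longleftrightarrow> (\<forall>i<t. p i \<oplus> \<ominus> q i = \<zero>)"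
    using assms by (simp add: low_zero_def a_minus_def[of P] a_inv_P add_P up_add_closed up_a_inv_closed)
  also have "\<dots> \<longleftrightarrow> (\<forall>i<t. p i = q i)"
    using assms by (metis a_inv_closed minus_equality minus_minus r_neg up_coeff)
  finally show ?thesis .
qed

end

lemma skew_poly_ring_skew_poly:
  "ring R \<Longrightarrow> \<sigma> \<in> Ring.ring_hom R R \<Longrightarrow> skew_poly_ring R \<sigma> (skew_poly R \<sigma>)"
  by (intro skew_poly_ring.intro skew_poly_ring_axioms.intro) (simp_all add: skew_poly_def)

lemma skew_poly_ring_UP: "ring R \<Longrightarrow> skew_poly_ring R id (UP R)"
  by (intro skew_poly_ring.intro skew_poly_ring_axioms.intro) (simp_all add: UP_def ring_hom_def)


section \<open>Cyclic index differences\<close>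

definition cyc_diff :: "nat \<Rightarrow> nat \<Rightarrow> nat \<Rightarrow> nat"
  where "cyc_diff t i j = nat ((int j - int i) mod int t)"

text \<open>For indices below t the difference exceeds -t, so at most one t has to be added. The
  case split turns the following index laws into linear arithmetic.\<close>

lemma cyc_diff_eq:
  assumes "i < t" "j < t"
  shows "cyc_diff t i j = (if i \<le> j then j - i else j + t - i)"
proof (cases "i \<le> j")
  case True
  with assms show ?thesis by (simp add: cyc_diff_def)
next
  case False
  have "(int j - int i) mod int t = (int j - int i + int t) mod int t" by simp
  also have "\<dots> = int j - int i + int t"
    using False assms by (intro mod_pos_pos_trivial) auto
  finally show ?thesis using False assms by (simp add: cyc_diff_def)
qed

lemma add_mod_eq: "i < t \<Longrightarrow> e < t \<Longrightarrow> (i + e) mod t = (if i + e < t then i + e else i + e - t)"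
  for i e t :: nat
  by (simp add: mod_if)

lemma cyc_diff_less: "i < t \<Longrightarrow> j < t \<Longrightarrow> cyc_diff t i j < t"
  by (auto simp: cyc_diff_eq)

lemma cyc_diff_add_mod: "i < t \<Longrightarrow> e < t \<Longrightarrow> cyc_diff t i ((i + e) mod t) = e"
  by (subst cyc_diff_eq) (auto simp: add_mod_eq)

lemma add_cyc_diff_mod: "i < t \<Longrightarrow> j < t \<Longrightarrow> (i + cyc_diff t i j) mod t = j"
  by (subst add_mod_eq) (auto simp: cyc_diff_eq)

text \<open>Gives the index of the second factor in entry (i, j) of a matrix product, at column k =
  i + e modulo t. Adding e to it yields d = \<open>cyc_diff t i j\<close> or d + t, which decides
  whether the term survives modulo z^t.\<close>

lemma cyc_diff_from_add_mod:
  "i < t \<Longrightarrow> e < t \<Longrightarrow> j < t \<Longrightarrow> cyc_diff t ((i + e) mod t) j =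
    (if e \<le> cyc_diff t i j then cyc_diff t i j - e else cyc_diff t i j + t - e)"
  by (subst cyc_diff_eq) (auto simp: add_mod_eq cyc_diff_eq)

lemma cyc_diff_self [simp]: "cyc_diff t i i = 0"
  by (simp add: cyc_diff_def)

text \<open>The inverse is \<open>cyc_diff t i\<close>. This permits replacing the summation index k
  of a matrix product by e = k - i modulo t.\<close>

lemma bij_betw_add_mod: "i < t \<Longrightarrow> bij_betw (\<lambda>e. (i + e) mod t) {..<t} {..<t}" for i t :: nat
  by (rule bij_betwI[of _ _ _ "cyc_diff t i"])
    (auto simp: cyc_diff_less cyc_diff_add_mod add_cyc_diff_mod)


section \<open>The embedding\<close>

locale skew_truncation = ring R for R (structure) +
  fixes \<sigma> :: "'a \<Rightarrow> 'a" and t :: nat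
  assumes t_pos: "t \<ge> 1"
    and hom: "\<sigma> \<in> Ring.ring_hom R R"
    and pow_t: "r \<in> carrier R \<Longrightarrow> (\<sigma> ^^ t) r = r"
begin

sublocale S: skew_poly_ring R \<sigma> "skew_poly R \<sigma>"
  by (rule skew_poly_ring_skew_poly[OF ring_axioms hom])

sublocale U: skew_poly_ring R id "UP R"
  by (rule skew_poly_ring_UP[OF ring_axioms])

section \<open>The two ideals and the cosets of monomials\<close>

lemma monom_UP: "a \<in> carrier R \<Longrightarrow> up_ring.monom (UP R) a n = skew_monom R a n"
  by (simp add: UP_def skew_monom_def)

lemma poly_ideal_eq: "poly_ideal R t = U.low_zero t"
  by (simp add: poly_ideal_def monom_UP U.genideal_monom)

lemma skew_ideal_eq: "skew_ideal R \<sigma> t = S.low_zero t"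
  by (simp add: skew_ideal_def S.skew_monom_pow S.genideal_monom)

sublocale UI: ideal "poly_ideal R t" "UP R"
  unfolding poly_ideal_eq by (rule U.ideal_low_zero)

sublocale SI: ideal "skew_ideal R \<sigma> t" "skew_poly R \<sigma>"
  unfolding skew_ideal_eq by (rule S.ideal_low_zero)

sublocale Q: ring "poly_quot R t"
  unfolding poly_quot_def by (rule UI.quotient_is_ring)

abbreviation (input) Q where "Q \<equiv> poly_quot R t"

lemma poly_coset_eq:
  "a \<in> carrier R \<Longrightarrow> poly_coset R t a n = poly_ideal R t +>\<^bsub>UP R\<^esub> skew_monom R a n"
  by (simp add: poly_coset_def monom_UP)

lemma poly_coset_closed [simp]: "a \<in> carrier R \<Longrightarrow> poly_coset R t a n \<in> carrier Q"
  by (simp add: poly_coset_eq poly_quot_def UI.FactRing_coset_simps U.carrier_P)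

lemma poly_coset_mult:
  "a \<in> carrier R \<Longrightarrow> b \<in> carrier R \<Longrightarrow>
    poly_coset R t a m \<otimes>\<^bsub>Q\<^esub> poly_coset R t b n = poly_coset R t (a \<otimes> b) (m + n)"
  by (simp add: poly_coset_eq poly_quot_def UI.FactRing_coset_simps U.carrier_P U.skew_monom_mult_P)

lemma poly_coset_add:
  "a \<in> carrier R \<Longrightarrow> b \<in> carrier R \<Longrightarrow>
    poly_coset R t a n \<oplus>\<^bsub>Q\<^esub> poly_coset R t b n = poly_coset R t (a \<oplus> b) n"
  by (simp add: poly_coset_eq poly_quot_def UI.FactRing_coset_simps U.carrier_P U.skew_monom_add)

lemma poly_coset_zero [simp]: "poly_coset R t \<zero> n = \<zero>\<^bsub>Q\<^esub>"
  by (simp add: poly_coset_eq poly_quot_def UI.FactRing_coset_simps U.skew_monom_zero)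

lemma poly_coset_one: "poly_coset R t \<one> 0 = \<one>\<^bsub>Q\<^esub>"
  by (simp add: poly_coset_eq poly_quot_def UI.FactRing_coset_simps U.one_P skew_monom_def)

text \<open>The two monomials can differ only in degree n, which is visible modulo z^t exactly when
  n < t.\<close>

lemma poly_coset_eq_iff:
  assumes "a \<in> carrier R" "b \<in> carrier R"
  shows "poly_coset R t a n = poly_coset R t b n \<longleftrightarrow> n < t \<longrightarrow> a = b"
proof -
  have "poly_coset R t a n = poly_coset R t b n
      \<longleftrightarrow> (\<forall>i<t. skew_monom R a n i = skew_monom R b n i)"
    using assms by (simp add: poly_coset_eq poly_ideal_eq U.low_zero_coset_eq_iff)
  then show ?thesis by (auto simp: skew_monom_def)
qed

lemma poly_coset_high: "a \<in> carrier R \<Longrightarrow> t \<le> n \<Longrightarrow> poly_coset R t a n = \<zero>\<^bsub>Q\<^esub>"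
  using poly_coset_eq_iff[of a \<zero> n] by simp

lemma poly_coset_finsum:
  assumes "finite I" "f \<in> I \<rightarrow> carrier R"
  shows "(\<Oplus>\<^bsub>Q\<^esub>i\<in>I. poly_coset R t (f i) n) = poly_coset R t (\<Oplus>i\<in>I. f i) n"
  using assms
proof (induction I rule: finite_induct)
  case (insert i I)
  then have "(\<Oplus>j\<in>insert i I. f j) = f i \<oplus> (\<Oplus>j\<in>I. f j)"
    and "(\<Oplus>\<^bsub>Q\<^esub>j\<in>insert i I. poly_coset R t (f j) n)
      = poly_coset R t (f i) n \<oplus>\<^bsub>Q\<^esub> (\<Oplus>\<^bsub>Q\<^esub>j\<in>I. poly_coset R t (f j) n)"
    by (auto simp: Pi_def intro!: finsum_insert Q.finsum_insert)
  with insert show ?case by (simp add: poly_coset_add)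
qed simp

text \<open>Here \<sigma>^t = 1 enters the multiplicativity: the power of \<sigma> in row (i + e)
  mod t becomes \<sigma>^i after \<sigma>^e.\<close>

lemma hom_pow_mod: "r \<in> carrier R \<Longrightarrow> (\<sigma> ^^ (n mod t)) r = (\<sigma> ^^ n) r"
proof (induction n rule: less_induct)
  case (less n)
  show ?case
  proof (cases "n < t")
    case False
    then have "(\<sigma> ^^ n) r = (\<sigma> ^^ (n - t)) ((\<sigma> ^^ t) r)"
      using funpow_add[of "n - t" t \<sigma>] by simp
    with False less t_pos show ?thesis by (simp add: pow_t le_mod_geq)
  qed simp
qed

section \<open>Matrices of coefficient sequences\<close>

lemma mu_matrix_simps:
  "dim_row (mu_matrix R \<sigma> t p) = t" "dim_col (mu_matrix R \<sigma> t p) = t"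
  "i < t \<Longrightarrow> j < t \<Longrightarrow> mu_matrix R \<sigma> t p $$ (i, j)
    = poly_coset R t ((\<sigma> ^^ i) (p (cyc_diff t i j))) (cyc_diff t i j)"
  by (simp_all add: mu_matrix_def cyc_diff_def Let_def)

text \<open>Cyclic differences lie below t, so only the first t coefficients are read. Hence the
  matrix can be formed from a whole polynomial as well as from its truncation.\<close>

lemma mu_matrix_cong: "(\<And>i. i < t \<Longrightarrow> p i = q i) \<Longrightarrow> mu_matrix R \<sigma> t p = mu_matrix R \<sigma> t q"
  by (intro eq_matI) (auto simp: mu_matrix_simps cyc_diff_less)

lemma mu_matrix_closed:
  "p \<in> {..<t} \<rightarrow> carrier R \<Longrightarrow> mu_matrix R \<sigma> t p \<in> carrier (matrix_ring t Q)"
  by (auto simp: matrix_ring_simps mu_matrix_simps Pi_def cyc_diff_less carrier_matI)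

lemma mu_matrix_inj:
  assumes "p \<in> {..<t} \<rightarrow> carrier R" "q \<in> {..<t} \<rightarrow> carrier R"
    and eq: "mu_matrix R \<sigma> t p = mu_matrix R \<sigma> t q" and i: "i < t"
  shows "p i = q i"
proof -
  \<comment> \<open>Row 0 carries \<sigma>^0, so its entry in column i is the coset of p_i z^i; as i
    < t, this determines p_i.\<close>
  have "cyc_diff t 0 i = i"
    using i by (simp add: cyc_diff_eq)
  then have "poly_coset R t (p i) i = poly_coset R t (q i) i"
    using mu_matrix_simps(3)[of 0 i p] mu_matrix_simps(3)[of 0 i q] i eq by simp
  then show ?thesis
    using assms by (subst (asm) poly_coset_eq_iff) auto
qed

lemma mu_matrix_one: "mu_matrix R \<sigma> t \<one>\<^bsub>skew_poly R \<sigma>\<^esub> = \<one>\<^bsub>matrix_ring t Q\<^esub>"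
  by (rule eq_matI)
    (auto simp: matrix_ring_simps mu_matrix_simps S.one_P poly_coset_one cyc_diff_eq)

lemma mu_matrix_add:
  assumes "p \<in> up R" "q \<in> up R"
  shows "mu_matrix R \<sigma> t (p \<oplus>\<^bsub>skew_poly R \<sigma>\<^esub> q)
    = mu_matrix R \<sigma> t p \<oplus>\<^bsub>matrix_ring t Q\<^esub> mu_matrix R \<sigma> t q"
  using assms by (intro eq_matI)
    (auto simp: matrix_ring_simps mu_matrix_simps S.add_P poly_coset_add)

text \<open>Stated for whole polynomials, so that the left side contains the plain skew product; its
  coefficients from degree t on are never read.\<close>

lemma mu_matrix_mult:
  assumes p: "p \<in> up R" and q: "q \<in> up R"
  shows "mu_matrix R \<sigma> t (p \<otimes>\<^bsub>skew_poly R \<sigma>\<^esub> q)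
    = mu_matrix R \<sigma> t p \<otimes>\<^bsub>matrix_ring t Q\<^esub> mu_matrix R \<sigma> t q"
proof (rule eq_matI, goal_cases)
  case (1 i j)
  then have i: "i < t" and j: "j < t"
    by (auto simp: matrix_ring_simps)
  define d where "d = cyc_diff t i j"
  have d: "d < t"
    using i j by (simp add: d_def cyc_diff_less)
  let ?M = "mu_matrix R \<sigma> t p" and ?N = "mu_matrix R \<sigma> t q"
  let ?f = "\<lambda>k. ?M $$ (i, k) \<otimes>\<^bsub>Q\<^esub> ?N $$ (k, j)"
  let ?g = "\<lambda>e. poly_coset R t ((\<sigma> ^^ i) (p e \<otimes> (\<sigma> ^^ e) (q (d - e)))) d"
  \<comment> \<open>The exponents add up to d if e \<le> d and to d + t otherwise; in the second
    case \<open>poly_coset_high\<close> gives zero.\<close>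
  have summand: "?f ((i + e) mod t) = (if e \<le> d then ?g e else \<zero>\<^bsub>Q\<^esub>)" if e: "e < t" for e
  proof -
    define l where "l = cyc_diff t ((i + e) mod t) j"
    have "?f ((i + e) mod t) = poly_coset R t ((\<sigma> ^^ i) (p e)) e
        \<otimes>\<^bsub>Q\<^esub> poly_coset R t ((\<sigma> ^^ ((i + e) mod t)) (q l)) l"
      using i j e t_pos by (simp add: mu_matrix_simps cyc_diff_add_mod l_def)
    also have "\<dots> = poly_coset R t ((\<sigma> ^^ i) (p e \<otimes> (\<sigma> ^^ e) (q l))) (e + l)"
      using p q by (simp add: hom_pow_mod poly_coset_mult funpow_add)
    also have "\<dots> = (if e \<le> d then ?g e else \<zero>\<^bsub>Q\<^esub>)"
      using p q i j e by (auto simp: l_def d_def cyc_diff_from_add_mod intro!: poly_coset_high)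
    finally show ?thesis .
  qed
  \<comment> \<open>The index set is written as the image of itself under the cyclic shift by i, to
    reindex by e.\<close>
  have "(\<Oplus>\<^bsub>Q\<^esub>k\<in>{..<t}. ?f k) = (\<Oplus>\<^bsub>Q\<^esub>k\<in>(\<lambda>e. (i + e) mod t) ` {..<t}. ?f k)"
    using bij_betw_add_mod[OF i] by (simp add: bij_betw_def)
  also have "\<dots> = (\<Oplus>\<^bsub>Q\<^esub>e\<in>{..<t}. ?f ((i + e) mod t))"
    using bij_betw_add_mod[OF i] p q i j
    by (intro Q.finsum_reindex) (auto simp: bij_betw_def mu_matrix_simps)
  also have "\<dots> = (\<Oplus>\<^bsub>Q\<^esub>e\<in>{..d}. ?g e)"
    using d p q by (intro Q.add.finprod_mono_neutral_cong_right) (auto simp: summand)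
  also have "\<dots> = poly_coset R t (\<Oplus>e\<in>{..d}. (\<sigma> ^^ i) (p e \<otimes> (\<sigma> ^^ e) (q (d - e)))) d"
    using p q by (intro poly_coset_finsum) auto
  \<comment> \<open>All remaining terms have the same degree d, and taking \<sigma>^i out of their
    sum leaves the d-th coefficient of the skew product.\<close>
  also have "(\<Oplus>e\<in>{..d}. (\<sigma> ^^ i) (p e \<otimes> (\<sigma> ^^ e) (q (d - e))))
      = (\<sigma> ^^ i) ((p \<otimes>\<^bsub>skew_poly R \<sigma>\<^esub> q) d)"
    using p q by (simp add: S.mult_P S.hom_pow_finsum Pi_def)
  finally show ?case
    using i j by (simp add: matrix_ring_simps(2) mu_matrix_simps(3) d_def)
qed (auto simp: matrix_ring_simps mu_matrix_simps)

section \<open>Passage from polynomials to cosets\<close>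

lemma truncate_in_up:
  assumes "r \<in> {..<t} \<rightarrow> carrier R"
  shows "(\<lambda>i. if i < t then r i else \<zero>) \<in> up R"
proof (rule mem_upI)
  show "\<exists>n. bound \<zero> n (\<lambda>i. if i < t then r i else \<zero>)"
    by (rule exI[of _ t]) (simp add: bound_def)
qed (use assms in auto)

text \<open>A sequence represents the coset of p exactly if it agrees with p below t. This evaluates
  the description in \<open>mu\<close> at an arbitrary representative and so reduces facts about
  \<open>mu\<close> to \<open>mu_matrix\<close>.\<close>

lemma mu_coset:
  assumes p: "p \<in> up R"
  shows "mu R \<sigma> t (skew_ideal R \<sigma> t +>\<^bsub>skew_poly R \<sigma>\<^esub> p) = mu_matrix R \<sigma> t p"
proof -
  let ?X = "skew_ideal R \<sigma> t +>\<^bsub>skew_poly R \<sigma>\<^esub> p"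
  have coset: "skew_coset R \<sigma> t r = ?X \<longleftrightarrow> (\<forall>i<t. r i = p i)"
    if r: "r \<in> {..<t} \<rightarrow>\<^sub>E carrier R" for r
  proof -
    have "r \<in> {..<t} \<rightarrow> carrier R"
      using r by (simp add: PiE_def)
    then show ?thesis
      using p S.low_zero_coset_eq_iff[OF truncate_in_up p]
      by (simp add: skew_coset_def skew_ideal_eq)
  qed
  have restr: "restrict p {..<t} \<in> {..<t} \<rightarrow>\<^sub>E carrier R"
    using p by simp
  \<comment> \<open>Extensionality fixes the values outside \<open>{..<t}\<close>, so the
    representing sequence is unique as a function.\<close>
  have "(THE r. r \<in> {..<t} \<rightarrow>\<^sub>E carrier R \<and> skew_coset R \<sigma> t r = ?X) = restrict p {..<t}"
  proof (rule the_equality)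
    show "restrict p {..<t} \<in> {..<t} \<rightarrow>\<^sub>E carrier R \<and> skew_coset R \<sigma> t (restrict p {..<t}) = ?X"
      using restr coset[OF restr] by simp
    fix r assume r: "r \<in> {..<t} \<rightarrow>\<^sub>E carrier R \<and> skew_coset R \<sigma> t r = ?X"
    show "r = restrict p {..<t}"
      by (rule PiE_ext[of _ "{..<t}" "\<lambda>_. carrier R"]) (use r restr coset[of r] in auto)
  qed
  then have "mu R \<sigma> t (skew_ideal R \<sigma> t +>\<^bsub>skew_poly R \<sigma>\<^esub> p)
      = mu_matrix R \<sigma> t (restrict p {..<t})"
    by (simp only: mu_def)
  also have "\<dots> = mu_matrix R \<sigma> t p"
    by (rule mu_matrix_cong) simp
  finally show ?thesis .
qed

lemma mu_skew_coset:
  assumes "r \<in> {..<t} \<rightarrow> carrier R"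
  shows "mu R \<sigma> t (skew_coset R \<sigma> t r) = mu_matrix R \<sigma> t r"
proof -
  have "mu R \<sigma> t (skew_coset R \<sigma> t r) = mu_matrix R \<sigma> t (\<lambda>i. if i < t then r i else \<zero>)"
    unfolding skew_coset_def by (rule mu_coset[OF truncate_in_up[OF assms]])
  also have "\<dots> = mu_matrix R \<sigma> t r"
    by (rule mu_matrix_cong) simp
  finally show ?thesis .
qed

lemma skew_quot_carrierE:
  assumes "X \<in> carrier (skew_quot R \<sigma> t)"
  obtains p where "p \<in> up R" "X = skew_ideal R \<sigma> t +>\<^bsub>skew_poly R \<sigma>\<^esub> p"
  using assms unfolding skew_quot_def by (auto elim!: FactRing_carrierE simp: S.carrier_P)

lemma ring_embedding_mu: "ring_embedding (skew_quot R \<sigma> t) (matrix_ring t Q) (mu R \<sigma> t)"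
  unfolding ring_embedding_def
proof
  note coset_simps = SI.FactRing_coset_simps[folded skew_quot_def, unfolded S.carrier_P]
  have up: "p \<in> up R \<Longrightarrow> p \<in> {..<t} \<rightarrow> carrier R" for p
    by auto
  show "ring_hom_ring (skew_quot R \<sigma> t) (matrix_ring t Q) (mu R \<sigma> t)"
  proof (rule ring_hom_ringI)
    show "ring (skew_quot R \<sigma> t)"
      unfolding skew_quot_def by (rule SI.quotient_is_ring)
    show "ring (matrix_ring t Q)"
      by (rule Q.matrix_ring_is_ring)
    have "\<one>\<^bsub>skew_poly R \<sigma>\<^esub> \<in> up R"
      using S.P.one_closed by (simp add: S.carrier_P)
    then show "mu R \<sigma> t \<one>\<^bsub>skew_quot R \<sigma> t\<^esub> = \<one>\<^bsub>matrix_ring t Q\<^esub>"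
      by (simp add: coset_simps mu_coset mu_matrix_one)
  qed (auto elim!: skew_quot_carrierE simp: coset_simps mu_coset mu_matrix_closed up
      S.up_closed_P mu_matrix_add mu_matrix_mult)
  show "inj_on (mu R \<sigma> t) (carrier (skew_quot R \<sigma> t))"
  proof (rule inj_onI)
    fix X Y
    assume "X \<in> carrier (skew_quot R \<sigma> t)" "Y \<in> carrier (skew_quot R \<sigma> t)"
      and eq: "mu R \<sigma> t X = mu R \<sigma> t Y"
    then obtain p q where pq: "p \<in> up R" "q \<in> up R"
      and XY: "X = skew_ideal R \<sigma> t +>\<^bsub>skew_poly R \<sigma>\<^esub> p"
        "Y = skew_ideal R \<sigma> t +>\<^bsub>skew_poly R \<sigma>\<^esub> q"
      by (auto elim!: skew_quot_carrierE)
    have "p i = q i" if "i < t" for i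
      using mu_matrix_inj[OF up up _ that, of p q] pq eq by (simp add: XY mu_coset)
    then show "X = Y"
      using pq by (simp add: XY skew_ideal_eq S.low_zero_coset_eq_iff)
  qed
qed

section \<open>The trace\<close>

lemma trace_mu:
  assumes r: "r \<in> {..<t} \<rightarrow> carrier R"
  shows "matrix_trace Q (mu R \<sigma> t (skew_coset R \<sigma> t r))
    = poly_coset R t (\<Oplus>i\<in>{..<t}. (\<sigma> ^^ i) (r 0)) 0"
proof -
  have r0: "r 0 \<in> carrier R"
    using r t_pos by auto
  \<comment> \<open>On the diagonal the cyclic difference is 0, so entry (i, i) is the coset of
    \<sigma>^i(r_0) in degree 0.\<close>
  have "matrix_trace Q (mu R \<sigma> t (skew_coset R \<sigma> t r))
      = (\<Oplus>\<^bsub>Q\<^esub>i\<in>{..<t}. poly_coset R t ((\<sigma> ^^ i) (r 0)) 0)"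
    unfolding matrix_trace_def mu_skew_coset[OF r] mu_matrix_simps(1)
    using r0 by (intro Q.finsum_cong') (auto simp: mu_matrix_simps)
  also have "\<dots> = poly_coset R t (\<Oplus>i\<in>{..<t}. (\<sigma> ^^ i) (r 0)) 0"
    using r0 by (intro poly_coset_finsum) auto
  finally show ?thesis .
qed

text \<open>Applying \<sigma> shifts the summands cyclically: the new last one is \<sigma>^t(x) = x,
  the old first one.\<close>

lemma sum_orbit_fixed:
  assumes x: "x \<in> carrier R"
  shows "(\<Oplus>i\<in>{..<t}. (\<sigma> ^^ i) x) \<in> fixed_ring R \<sigma>"
proof -
  obtain n where n: "t = Suc n"
    using t_pos by (cases t) auto
  have "\<sigma> (\<Oplus>i\<in>{..n}. (\<sigma> ^^ i) x) = (\<Oplus>i\<in>{..n}. (\<sigma> ^^ Suc i) x)"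
    using S.hom_pow_finsum[of "{..n}" "\<lambda>i. (\<sigma> ^^ i) x" 1] x by simp
  also have "\<dots> = (\<Oplus>i\<in>{..n}. (\<sigma> ^^ i) x)"
  proof (cases n)
    case 0
    with pow_t[OF x] n x show ?thesis by simp
  next
    case (Suc m)
    \<comment> \<open>Here t = \<open>Suc (Suc m)\<close>, so the top summand split off equals x =
      \<sigma>^0(x) and can be put back at the bottom.\<close>
    have "(\<Oplus>i\<in>{..Suc m}. (\<sigma> ^^ Suc i) x) = (\<sigma> ^^ Suc (Suc m)) x \<oplus> (\<Oplus>i\<in>{..m}. (\<sigma> ^^ Suc i) x)"
      using x by (intro finsum_Suc) (auto simp del: funpow.simps)
    also have "\<dots> = (\<Oplus>i\<in>{..m}. (\<sigma> ^^ Suc i) x) \<oplus> (\<sigma> ^^ 0) x"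
      using x pow_t[OF x] n Suc by (subst a_comm) (auto simp del: funpow.simps(2) intro!: finsum_closed)
    also have "\<dots> = (\<Oplus>i\<in>{..Suc m}. (\<sigma> ^^ i) x)"
      using x by (intro finsum_Suc2[symmetric]) auto
    finally show ?thesis using Suc by simp
  qed
  finally show ?thesis
    using x n by (auto simp: fixed_ring_def lessThan_Suc_atMost intro!: finsum_closed)
qed

end


section \<open>Scalars\<close>

lemma alg_hom_pow:
  assumes A: "nc_algebra K A" and \<sigma>: "\<sigma> \<in> alg_hom K A A" and k: "k \<in> carrier K"
    and a: "a \<in> carrier A"
  shows "(\<sigma> ^^ n) (k \<odot>\<^bsub>A\<^esub> a) = k \<odot>\<^bsub>A\<^esub> (\<sigma> ^^ n) a"
proof -
  \<comment> \<open>Membership in the carrier is carried through the induction because \<sigma> is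
    linear only on the carrier.\<close>
  have "(\<sigma> ^^ n) a \<in> carrier A \<and> (\<sigma> ^^ n) (k \<odot>\<^bsub>A\<^esub> a) = k \<odot>\<^bsub>A\<^esub> (\<sigma> ^^ n) a"
    using \<sigma> k a by (induction n) (auto simp: alg_hom_def ring_hom_closed)
  then show ?thesis ..
qed

lemma coeff_smult_closed:
  assumes A: "nc_algebra K A" and k: "k \<in> carrier K" and p: "p \<in> up A"
  shows "coeff_smult A k p \<in> up A"
proof (rule mem_upI)
  interpret A: nc_algebra K A by (rule A)
  show "coeff_smult A k p n \<in> carrier A" for n
    using k mem_upD[OF p] by (simp add: coeff_smult_def)
  obtain n where n: "bound \<zero>\<^bsub>A\<^esub> n p"
    using A.A.bound_upD[OF p] by blast
  have "bound \<zero>\<^bsub>A\<^esub> n (coeff_smult A k p)"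
    using k by (auto simp: coeff_smult_def bound.bound[OF n])
  then show "\<exists>n. bound \<zero>\<^bsub>A\<^esub> n (coeff_smult A k p)" by blast
qed

text \<open>Compatibility of scalars with the right factor is where K-linearity of \<sigma> enters:
  k (a \<sigma>^i(b)) = a \<sigma>^i(k b). Taking \<sigma> or \<open>id\<close> covers both
  polynomial rings.\<close>

lemma nc_algebra_coeff_smult:
  assumes A: "nc_algebra K A" and P: "skew_poly_ring A \<sigma> P" and \<sigma>: "\<sigma> \<in> alg_hom K A A"
  shows "nc_algebra K (with_smult P (coeff_smult A))"
proof -
  interpret A: nc_algebra K A by (rule A)
  interpret P: skew_poly_ring A \<sigma> P by (rule P)
  note closed = coeff_smult_closed[OF A]
  show ?thesis
  proof (rule nc_algebra_with_smultI)
    fix k p q assume k: "k \<in> carrier K" and "p \<in> carrier P" "q \<in> carrier P"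
    then have pq: "p \<in> up A" "q \<in> up A"
      by (simp_all add: P.carrier_P)
    have dist: "k \<odot>\<^bsub>A\<^esub> (\<Oplus>\<^bsub>A\<^esub>i\<in>{..n}. p i \<otimes>\<^bsub>A\<^esub> (\<sigma> ^^ i) (q (n - i)))
        = (\<Oplus>\<^bsub>A\<^esub>i\<in>{..n}. k \<odot>\<^bsub>A\<^esub> (p i \<otimes>\<^bsub>A\<^esub> (\<sigma> ^^ i) (q (n - i))))" for n
      using k pq by (intro A.finsum_smult_ldistr) auto
    show "coeff_smult A k (p \<otimes>\<^bsub>P\<^esub> q) = coeff_smult A k p \<otimes>\<^bsub>P\<^esub> q"
    proof
      fix n
      have "coeff_smult A k (p \<otimes>\<^bsub>P\<^esub> q) n
          = (\<Oplus>\<^bsub>A\<^esub>i\<in>{..n}. k \<odot>\<^bsub>A\<^esub> (p i \<otimes>\<^bsub>A\<^esub> (\<sigma> ^^ i) (q (n - i))))"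
        using pq by (simp add: P.mult_P coeff_smult_def dist)
      also have "\<dots> = (\<Oplus>\<^bsub>A\<^esub>i\<in>{..n}. coeff_smult A k p i \<otimes>\<^bsub>A\<^esub> (\<sigma> ^^ i) (q (n - i)))"
        using k pq by (intro A.M.finsum_cong') (auto simp: A.smult_mult_left coeff_smult_def)
      also have "\<dots> = (coeff_smult A k p \<otimes>\<^bsub>P\<^esub> q) n"
        using k pq by (simp add: P.mult_P closed)
      finally show "coeff_smult A k (p \<otimes>\<^bsub>P\<^esub> q) n = (coeff_smult A k p \<otimes>\<^bsub>P\<^esub> q) n" .
    qed
    show "coeff_smult A k (p \<otimes>\<^bsub>P\<^esub> q) = p \<otimes>\<^bsub>P\<^esub> coeff_smult A k q"
    proof
      fix n
      have "coeff_smult A k (p \<otimes>\<^bsub>P\<^esub> q) n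
          = (\<Oplus>\<^bsub>A\<^esub>i\<in>{..n}. k \<odot>\<^bsub>A\<^esub> (p i \<otimes>\<^bsub>A\<^esub> (\<sigma> ^^ i) (q (n - i))))"
        using pq by (simp add: P.mult_P coeff_smult_def dist)
      also have "\<dots> = (\<Oplus>\<^bsub>A\<^esub>i\<in>{..n}. p i \<otimes>\<^bsub>A\<^esub> (\<sigma> ^^ i) (coeff_smult A k q (n - i)))"
        using k pq by (intro A.M.finsum_cong')
          (auto simp: A.smult_mult_right coeff_smult_def alg_hom_pow[OF A \<sigma>])
      also have "\<dots> = (p \<otimes>\<^bsub>P\<^esub> coeff_smult A k q) n"
        using k pq by (simp add: P.mult_P closed)
      finally show "coeff_smult A k (p \<otimes>\<^bsub>P\<^esub> q) n = (p \<otimes>\<^bsub>P\<^esub> coeff_smult A k q) n" .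
    qed
    show "coeff_smult A k (p \<oplus>\<^bsub>P\<^esub> q) = coeff_smult A k p \<oplus>\<^bsub>P\<^esub> coeff_smult A k q"
      using k pq closed by (simp add: P.add_P) (simp add: coeff_smult_def A.smult_r_distr)
  next
    fix k l p assume k: "k \<in> carrier K" "l \<in> carrier K" and "p \<in> carrier P"
    then have p: "p \<in> up A"
      by (simp add: P.carrier_P)
    show "coeff_smult A (k \<oplus>\<^bsub>K\<^esub> l) p = coeff_smult A k p \<oplus>\<^bsub>P\<^esub> coeff_smult A l p"
      using k p closed by (simp add: P.add_P) (simp add: coeff_smult_def A.smult_l_distr)
    show "coeff_smult A (k \<otimes>\<^bsub>K\<^esub> l) p = coeff_smult A k (coeff_smult A l p)"
      using k p by (simp add: coeff_smult_def A.smult_assoc1)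
  next
    fix p assume "p \<in> carrier P"
    then show "coeff_smult A \<one>\<^bsub>K\<^esub> p = p"
      by (simp add: P.carrier_P coeff_smult_def)
  qed (simp_all add: A.R.is_cring P.P.ring_axioms P.carrier_P closed)
qed

text \<open>Supplies the stability condition of \<open>nc_algebra_quot\<close> for both (w^t) and
  (z^t), as \<open>low_zero\<close> mentions neither \<sigma> nor \<open>P\<close>.\<close>

lemma coeff_smult_low_zero:
  assumes A: "nc_algebra K A" and P: "skew_poly_ring A \<sigma> P"
    and k: "k \<in> carrier K" and p: "p \<in> skew_poly_ring.low_zero A t"
  shows "coeff_smult A k p \<in> skew_poly_ring.low_zero A t"
proof -
  interpret A: nc_algebra K A by (rule A)
  interpret P: skew_poly_ring A \<sigma> P by (rule P)
  show ?thesis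
    using p k coeff_smult_closed[OF A k] by (auto simp: P.low_zero_def) (simp add: coeff_smult_def)
qed

lemma id_alg_hom: "id \<in> alg_hom K A A"
  by (auto simp: alg_hom_def ring_hom_def)

lemma alg_embedding_mu:
  assumes A: "nc_algebra K A" and \<sigma>: "\<sigma> \<in> alg_hom K A A" and T: "skew_truncation A \<sigma> t"
  shows "alg_embedding K (skew_quot_alg A \<sigma> t) (matrix_alg t (poly_quot_alg A t)) (mu A \<sigma> t)"
proof -
  interpret A: nc_algebra K A by (rule A)
  interpret skew_truncation A \<sigma> t by (rule T)
  let ?s = "coeff_smult A"
  note U = nc_algebra_coeff_smult[OF A U.skew_poly_ring_axioms id_alg_hom]
  note S = nc_algebra_coeff_smult[OF A S.skew_poly_ring_axioms \<sigma>]
  interpret U: nc_algebra K "with_smult (UP A) ?s" by (rule U)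
  interpret S: nc_algebra K "with_smult (skew_poly A \<sigma>) ?s" by (rule S)
  have "nc_algebra K (poly_quot_alg A t)"
    unfolding poly_quot_alg_def poly_quot_def
    using coeff_smult_low_zero[OF A U.skew_poly_ring_axioms]
    by (intro nc_algebra_quot[OF U UI.is_ideal]) (simp add: poly_ideal_eq)
  then have alg_M: "nc_algebra K (matrix_alg t (poly_quot_alg A t))"
    by (rule nc_algebra_matrix_alg)
  have alg_S: "nc_algebra K (skew_quot_alg A \<sigma> t)"
    unfolding skew_quot_alg_def skew_quot_def
    using coeff_smult_low_zero[OF A S.skew_poly_ring_axioms]
    by (intro nc_algebra_quot[OF S SI.is_ideal]) (simp add: skew_ideal_eq)
  have smult_S: "quot_smult (skew_poly A \<sigma>) (skew_ideal A \<sigma> t) ?s k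
      (skew_ideal A \<sigma> t +>\<^bsub>skew_poly A \<sigma>\<^esub> p) = skew_ideal A \<sigma> t +>\<^bsub>skew_poly A \<sigma>\<^esub> ?s k p"
    if "k \<in> carrier K" "p \<in> up A" for k p
    using that S.smult_closed[of k] S.smult_r_distr[of k]
      coeff_smult_low_zero[OF A S.skew_poly_ring_axioms]
    by (intro S.P.quot_smult_coset SI.is_ideal) (auto simp: S.carrier_P skew_ideal_eq)
  have smult_coset: "quot_smult (UP A) (poly_ideal A t) ?s k (poly_coset A t a n)
      = poly_coset A t (k \<odot>\<^bsub>A\<^esub> a) n" if "k \<in> carrier K" "a \<in> carrier A" for k a n
  proof -
    have "?s k (skew_monom A a n) = skew_monom A (k \<odot>\<^bsub>A\<^esub> a) n"
      using that by (auto simp: coeff_smult_def skew_monom_def)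
    moreover have "quot_smult (UP A) (poly_ideal A t) ?s k
        (poly_ideal A t +>\<^bsub>UP A\<^esub> skew_monom A a n) = poly_ideal A t +>\<^bsub>UP A\<^esub> ?s k (skew_monom A a n)"
      using that U.smult_closed[of k] U.smult_r_distr[of k]
        coeff_smult_low_zero[OF A U.skew_poly_ring_axioms]
      by (intro U.P.quot_smult_coset UI.is_ideal) (auto simp: U.carrier_P poly_ideal_eq)
    ultimately show ?thesis
      using that by (simp add: poly_coset_eq)
  qed
  \<comment> \<open>On representatives this is the entrywise identity \<sigma>^i(k p_d) z^d = k
    \<sigma>^i(p_d) z^d, with d the cyclic difference.\<close>
  have linear: "mu A \<sigma> t (k \<odot>\<^bsub>skew_quot_alg A \<sigma> t\<^esub> X)
      = k \<odot>\<^bsub>matrix_alg t (poly_quot_alg A t)\<^esub> mu A \<sigma> t X"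
    if k: "k \<in> carrier K" and X: "X \<in> carrier (skew_quot A \<sigma> t)" for k X
  proof -
    obtain p where p: "p \<in> up A" "X = skew_ideal A \<sigma> t +>\<^bsub>skew_poly A \<sigma>\<^esub> p"
      using X by (rule skew_quot_carrierE)
    have "mu A \<sigma> t (k \<odot>\<^bsub>skew_quot_alg A \<sigma> t\<^esub> X) = mu_matrix A \<sigma> t (?s k p)"
      using k p by (simp add: skew_quot_alg_def smult_S mu_coset coeff_smult_closed[OF A])
    also have "\<dots> = k \<odot>\<^bsub>matrix_alg t (poly_quot_alg A t)\<^esub> mu_matrix A \<sigma> t p"
      using k p(1) by (intro eq_matI)
        (auto simp: matrix_alg_def poly_quot_alg_def mu_matrix_simps smult_coset
          coeff_smult_def[of A k p] alg_hom_pow[OF A \<sigma>])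
    finally show ?thesis
      using p by (simp add: mu_coset)
  qed
  \<comment> \<open>\<open>with_smult\<close> keeps carriers and ring operations, so the ring
    embedding supplies everything but linearity.\<close>
  have "mu A \<sigma> t \<in> Ring.ring_hom (skew_quot A \<sigma> t) (matrix_ring t (poly_quot A t))"
    and inj: "inj_on (mu A \<sigma> t) (carrier (skew_quot A \<sigma> t))"
    using ring_embedding_mu by (auto simp: ring_embedding_def ring_hom_ring_def ring_hom_ring_axioms_def)
  then have "mu A \<sigma> t \<in> Ring.ring_hom (skew_quot_alg A \<sigma> t) (matrix_alg t (poly_quot_alg A t))"
    by (simp add: ring_hom_def skew_quot_alg_def matrix_alg_def poly_quot_alg_def)
  then have "mu A \<sigma> t \<in> alg_hom K (skew_quot_alg A \<sigma> t) (matrix_alg t (poly_quot_alg A t))"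
    using linear by (simp add: alg_hom_def) (simp add: skew_quot_alg_def)
  then show ?thesis
    using alg_M alg_S inj by (simp add: alg_embedding_def) (simp add: skew_quot_alg_def)
qed

lemma matrix_trace_with_smult [simp]: "matrix_trace (with_smult S s) = matrix_trace S"
  by (simp add: matrix_trace_def fun_eq_iff)

theorem theorem2p2:
  fixes R :: "('a, 'm) ring_scheme"
    and K :: "('k, 'n) ring_scheme"
    and A :: "('k, 'b, 'p) module_scheme"
    and t :: nat
  assumes t: "t \<ge> 1"
  shows
   "(\<forall>\<sigma>. ring R \<and> \<sigma> \<in> Ring.ring_hom R R \<and> (\<forall>r\<in>carrier R. (\<sigma> ^^ t) r = r) \<longrightarrow>
      ring_embedding (skew_quot R \<sigma> t) (matrix_ring t (poly_quot R t)) (mu R \<sigma> t) \<and>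
      (\<forall>r. r \<in> {..<t} \<rightarrow> carrier R \<longrightarrow>
        mu R \<sigma> t (skew_coset R \<sigma> t r) = mu_matrix R \<sigma> t r \<and>
        matrix_trace (poly_quot R t) (mu R \<sigma> t (skew_coset R \<sigma> t r))
          = poly_coset R t (\<Oplus>\<^bsub>R\<^esub>i\<in>{..<t}. (\<sigma> ^^ i) (r 0)) 0 \<and>
        matrix_trace (poly_quot R t) (mu R \<sigma> t (skew_coset R \<sigma> t r))
          \<in> {poly_coset R t a 0 | a. a \<in> fixed_ring R \<sigma>}))
    \<and>
    (\<forall>\<sigma>. char_zero_field K \<and> nc_algebra K A \<and> \<sigma> \<in> alg_hom K A A \<and>
      (\<forall>r\<in>carrier A. (\<sigma> ^^ t) r = r) \<longrightarrow>
      alg_embedding K (skew_quot_alg A \<sigma> t) (matrix_alg t (poly_quot_alg A t)) (mu A \<sigma> t) \<and>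
      (\<forall>r. r \<in> {..<t} \<rightarrow> carrier A \<longrightarrow>
        mu A \<sigma> t (skew_coset A \<sigma> t r) = mu_matrix A \<sigma> t r \<and>
        matrix_trace (poly_quot_alg A t) (mu A \<sigma> t (skew_coset A \<sigma> t r))
          = poly_coset A t (\<Oplus>\<^bsub>A\<^esub>i\<in>{..<t}. (\<sigma> ^^ i) (r 0)) 0 \<and>
        matrix_trace (poly_quot_alg A t) (mu A \<sigma> t (skew_coset A \<sigma> t r))
          \<in> {poly_coset A t a 0 | a. a \<in> fixed_ring A \<sigma>}))"
proof (intro conjI allI impI; (elim conjE)?)
  fix \<sigma>
  assume R: "ring R" and \<sigma>: "\<sigma> \<in> Ring.ring_hom R R" "\<forall>r\<in>carrier R. (\<sigma> ^^ t) r = r"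
  interpret skew_truncation R \<sigma> t
    using R \<sigma> t by (intro skew_truncation.intro skew_truncation_axioms.intro) auto
  show "ring_embedding (skew_quot R \<sigma> t) (matrix_ring t (poly_quot R t)) (mu R \<sigma> t)"
    by (rule ring_embedding_mu)
  fix r assume r: "r \<in> {..<t} \<rightarrow> carrier R"
  have r0: "r 0 \<in> carrier R"
    using t by (intro funcset_mem[OF r]) simp
  show "mu R \<sigma> t (skew_coset R \<sigma> t r) = mu_matrix R \<sigma> t r"
    by (rule mu_skew_coset[OF r])
  show "matrix_trace (poly_quot R t) (mu R \<sigma> t (skew_coset R \<sigma> t r))
      = poly_coset R t (\<Oplus>\<^bsub>R\<^esub>i\<in>{..<t}. (\<sigma> ^^ i) (r 0)) 0"
    by (rule trace_mu[OF r])
  \<comment> \<open>The witness is the orbit sum of \<open>r 0\<close>.\<close>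
  then show "matrix_trace (poly_quot R t) (mu R \<sigma> t (skew_coset R \<sigma> t r))
      \<in> {poly_coset R t a 0 | a. a \<in> fixed_ring R \<sigma>}"
    using sum_orbit_fixed[OF r0] by blast
next
  fix \<sigma>
  assume A: "nc_algebra K A" and \<sigma>: "\<sigma> \<in> alg_hom K A A" "\<forall>r\<in>carrier A. (\<sigma> ^^ t) r = r"
  have "ring A"
    using A by (simp add: nc_algebra_def)
  then interpret skew_truncation A \<sigma> t
    using \<sigma> t by (intro skew_truncation.intro skew_truncation_axioms.intro) (auto simp: alg_hom_def)
  show "alg_embedding K (skew_quot_alg A \<sigma> t) (matrix_alg t (poly_quot_alg A t)) (mu A \<sigma> t)"
    by (rule alg_embedding_mu[OF A \<sigma>(1) skew_truncation_axioms])
  fix r assume r: "r \<in> {..<t} \<rightarrow> carrier A"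
  have r0: "r 0 \<in> carrier A"
    using t by (intro funcset_mem[OF r]) simp
  show "mu A \<sigma> t (skew_coset A \<sigma> t r) = mu_matrix A \<sigma> t r"
    by (rule mu_skew_coset[OF r])
  \<comment> \<open>The trace does not see scalars, so the ring formula applies through
    \<open>matrix_trace_with_smult\<close>.\<close>
  show "matrix_trace (poly_quot_alg A t) (mu A \<sigma> t (skew_coset A \<sigma> t r))
      = poly_coset A t (\<Oplus>\<^bsub>A\<^esub>i\<in>{..<t}. (\<sigma> ^^ i) (r 0)) 0"
    using trace_mu[OF r] by (simp add: poly_quot_alg_def)
  then show "matrix_trace (poly_quot_alg A t) (mu A \<sigma> t (skew_coset A \<sigma> t r))
      \<in> {poly_coset A t a 0 | a. a \<in> fixed_ring A \<sigma>}"
    using sum_orbit_fixed[OF r0] by blast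
qed

end
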